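(* Let $X$ and $Y$ be normed linear spaces, let $F:X\rightrightarrows Y$ be a set-valued mapping and $(\bar x,\bar y)\in\operatorname{gph}F:=\{(x,y)\in X\times Y: y\in F(x)\}$. Let $\mathbf{\Omega}=\{\Omega_1,\Omega_2\}$ be the collection of the two sets $\Omega_1=\operatorname{gph}F$ and $\Omega_2=X\times\{\bar y\}$ in $X\times Y$. (i) $F$ is metrically semiregular at $(\bar x,\bar y)$ if and only if $\mathbf{\Omega}$ is semiregular at $(\bar x,\bar y)$. Moreover, $$\frac{\theta[F](\bar x,\bar y)}{\theta[F](\bar x,\bar y)+2}\le\theta[\mathbf{\Omega}](\bar x,\bar y)\le\theta[F](\bar x,\bar y)/2.$$ (ii) $F$ is metrically subregular at $(\bar x,\bar y)$ if and only if $\mathbf{\Omega}$ is subregular at $(\bar x,\bar y)$. Moreover, $$\frac{\zeta[F](\bar x,\bar y)}{\zeta[F](\bar x,\bar y)+2}\le\zeta[\mathbf{\Omega}](\bar x,\bar y)\le\min\{\zeta[F](\bar x,\bar y)/2,1\}.$$ (iii) $F$ is metrically regular at $(\bar x,\bar y)$ if and only if $\mathbf{\Omega}$ is uniformly regular at $(\bar x,\bar y)$. Moreover, $$\frac{\hat\theta[F](\bar x,\bar y)}{\hat\theta[F](\bar x,\bar y)+2}\le\hat\theta[\mathbf{\Omega}](\bar x,\bar y)\le\min\{\hat\theta[F](\bar x,\bar y)/2,1\}.$$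
   Context: $X\times Y$ carries the maximum norm. $\mathbb{B}$ denotes a closed unit ball, $B_\delta(\cdot)$ a closed ball of radius $\delta$, $d(x,\Omega)=\inf_{\omega\in\Omega}\|x-\omega\|$ with $d(x,\emptyset)=+\infty$, $d(y,\bar y)=\|y-\bar y\|$, and $F^{-1}(y)=\{x: y\in F(x)\}$. All constants below lie in $[0,+\infty]$, and $\frac{t}{t+2}$ is read as $1$ for $t=+\infty$. Regularity of $F$ at $(\bar x,\bar y)$: - metrically semiregular: there are $\gamma,\delta>0$ with $\gamma d(\bar x,F^{-1}(y))\le d(y,\bar y)$ for all $y\in B_\delta(\bar y)$; - metrically subregular: there are $\gamma,\delta>0$ with $\gamma d(x,F^{-1}(\bar y))\le d(\bar y,F(x))$ for all $x\in B_\delta(\bar x)$; - metrically regular: there are $\gamma,\delta>0$ with $\gamma d(x,F^{-1}(y))\le d(y,F(x))$ for all $(x,y)\in B_\delta(\bar x,\bar y)$. The exact upper bounds of all $\gamma$ such that the respective property holds (for some $\delta>0$) are denoted $\theta[F](\bar x,\bar y)$, $\zeta[F](\bar x,\bar y)$, $\hat\theta[F](\bar x,\bar y)$ respectively (equal to $0$ if no positive $\gamma$ works). Regularity of a collection $\mathbf{\Omega}=\{\Omega_1,\ldots,\Omega_m\}$ ($m\ge2$) of sets in a normed space $Z$ at $\bar z\in\bigcap_i\Omega_i$ (here used with $Z=X\times Y$, $\bar z=(\bar x,\bar y)$, $m=2$): - semiregular: there exist $\alpha,\delta>0$ such that $\bigcap_{i}(\Omega_i-z_i)\cap B_\rho(\bar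 z)\ne\emptyset$ for all $\rho\in]0,\delta[$ and all $z_i\in Z$ with $\max_i\|z_i\|\le\alpha\rho$; - subregular: there exist $\alpha,\delta>0$ such that $\bigcap_{i}(\Omega_i+(\alpha\rho)\mathbb{B})\cap B_\delta(\bar z)\subseteq(\bigcap_{i}\Omega_i)+\rho\mathbb{B}$ for all $\rho\in]0,\delta[$; - uniformly regular: there exist $\alpha,\delta>0$ such that $\bigcap_{i}(\Omega_i-\omega_i-z_i)\cap(\rho\mathbb{B})\ne\emptyset$ for all $\rho\in]0,\delta[$, $\omega_i\in\Omega_i\cap B_\delta(\bar z)$, and all $z_i\in Z$ with $\max_i\|z_i\|\le\alpha\rho$. Constants: for $\rho,\delta>0$, $$\theta_\rho[\mathbf{\Omega}](\bar z):=\sup\Big\{r\ge0:\ \bigcap_{i}(\Omega_i-z_i)\cap B_\rho(\bar z)\ne\emptyset\ \ \forall z_i\in r\mathbb{B}\Big\},$$ $$\zeta_{\rho,\delta}[\mathbf{\Omega}](\bar z):=\sup\Big\{r\ge0:\ \bigcap_{i}(\Omega_i+r\mathbb{B})\cap B_\delta(\bar z)\subseteq\bigcap_{i}\Omega_i+\rho\mathbb{B}\Big\},$$ $$\theta[\mathbf{\Omega}](\bar z):=\liminf_{\rho\downarrow0}\frac{\theta_\rho[\mathbf{\Omega}](\bar z)}{\rho},\quad \zeta[\mathbf{\Omega}](\bar z):=\lim_{\delta\downarrow0}\inf_{0<\rho<\delta}\frac{\zeta_{\rho,\delta}[\mathbf{\Omega}](\bar z)}{\rho},$$ $$\hat\theta[\mathbf{\Omega}](\bar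 z):=\liminf_{\omega_i\to\bar z,\ \omega_i\in\Omega_i,\ \rho\downarrow0}\frac{\theta_\rho[\Omega_1-\omega_1,\ldots,\Omega_m-\omega_m](0)}{\rho}.$$
   Formalization: The upper bounds min{·/2, 1} in (ii) and (iii) are stated only for Y ≠ {0}; for Y = {0} and F(x) = {0} for all x, both constants of the collection equal +∞, so the printed bound by 1 fails. *)

theory Defs
  imports "HOL-Analysis.Analysis" "HOL-Library.Set_Algebras"
begin

section \<open>Product of two normed spaces with the maximum norm\<close>

text \<open>The library norm on \<^typ>\<open>'a \<times> 'b\<close> is the Euclidean one, so the product with the
  maximum norm is a type of its own.\<close>

datatype ('a, 'b) max_prod = MaxPair (mfst: 'a) (msnd: 'b)

instantiation max_prod :: (ab_group_add, ab_group_add) ab_group_add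
begin

definition zero_max_prod_def: "0 = MaxPair 0 0"

definition plus_max_prod_def: "p + q = MaxPair (mfst p + mfst q) (msnd p + msnd q)"

definition minus_max_prod_def: "p - q = MaxPair (mfst p - mfst q) (msnd p - msnd q)"

definition uminus_max_prod_def: "- p = MaxPair (- mfst p) (- msnd p)"

instance
  by standard
    (simp_all add: zero_max_prod_def plus_max_prod_def minus_max_prod_def uminus_max_prod_def
      algebra_simps)

end

instantiation max_prod :: (real_vector, real_vector) real_vector
begin

definition scaleR_max_prod_def: "scaleR c p = MaxPair (scaleR c (mfst p)) (scaleR c (msnd p))"

instance
  by standard (simp_all add: plus_max_prod_def scaleR_max_prod_def algebra_simps)

end

instantiation max_prod :: (real_normed_vector, real_normed_vector) real_normed_vector
begin

definition norm_max_prod_def: "norm p = max (norm (mfst p)) (norm (msnd p))"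

definition sgn_max_prod_def: "sgn (p :: ('a, 'b) max_prod) = p /\<^sub>R norm p"

definition dist_max_prod_def: "dist (p :: ('a, 'b) max_prod) q = norm (p - q)"

definition uniformity_max_prod_def:
  "(uniformity :: (('a, 'b) max_prod \<times> ('a, 'b) max_prod) filter) =
    (INF e\<in>{0<..}. principal {(p, q). dist p q < e})"

definition open_max_prod_def:
  "open (U :: ('a, 'b) max_prod set) \<longleftrightarrow> (\<forall>p\<in>U. \<forall>\<^sub>F (p', q) in uniformity. p' = p \<longrightarrow> q \<in> U)"

instance
proof
  fix p q :: "('a, 'b) max_prod" and a :: real and U :: "('a, 'b) max_prod set"
  show "dist p q = norm (p - q)"
    by (rule dist_max_prod_def)
  show "sgn p = p /\<^sub>R norm p"
    by (rule sgn_max_prod_def)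
  show "(uniformity :: (('a, 'b) max_prod \<times> ('a, 'b) max_prod) filter) =
      (INF e\<in>{0<..}. principal {(p, q). dist p q < e})"
    by (rule uniformity_max_prod_def)
  show "open U \<longleftrightarrow> (\<forall>p\<in>U. \<forall>\<^sub>F (p', q) in uniformity. p' = p \<longrightarrow> q \<in> U)"
    by (rule open_max_prod_def)
  have "norm p \<le> 0 \<longleftrightarrow> p = 0"
    by (cases p) (simp add: norm_max_prod_def zero_max_prod_def)
  moreover have "0 \<le> norm p"
    by (simp add: norm_max_prod_def le_max_iff_disj)
  ultimately show "norm p = 0 \<longleftrightarrow> p = 0"
    by linarith
  show "norm (p + q) \<le> norm p + norm q"
    using norm_triangle_ineq[of "mfst p" "mfst q"] norm_triangle_ineq[of "msnd p" "msnd q"]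
    unfolding norm_max_prod_def plus_max_prod_def max_prod.sel by linarith
  show "norm (a *\<^sub>R p) = \<bar>a\<bar> * norm p"
    by (simp add: norm_max_prod_def scaleR_max_prod_def max_mult_distrib_left)
qed

end


section \<open>Regularity of set-valued mappings\<close>

definition gph :: "('a \<Rightarrow> 'b set) \<Rightarrow> ('a, 'b) max_prod set" where
  "gph F = {MaxPair x y | x y. y \<in> F x}"

definition inv_map :: "('a \<Rightarrow> 'b set) \<Rightarrow> 'b \<Rightarrow> 'a set" where
  "inv_map F y = {x. y \<in> F x}"

text \<open>Unlike \<^const>\<open>infdist\<close>, the distance to the empty set is \<open>\<infinity>\<close>.\<close>

definition set_dist :: "'a::real_normed_vector \<Rightarrow> 'a set \<Rightarrow> ennreal" where
  "set_dist x S = (INF s\<in>S. ennreal (norm (x - s)))"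

definition metric_semireg_with ::
  "('a::real_normed_vector \<Rightarrow> 'b::real_normed_vector set) \<Rightarrow> 'a \<Rightarrow> 'b \<Rightarrow> real \<Rightarrow> bool" where
  "metric_semireg_with F xb yb \<gamma> \<longleftrightarrow>
    (\<exists>\<delta>>0. \<forall>y\<in>cball yb \<delta>. ennreal \<gamma> * set_dist xb (inv_map F y) \<le> ennreal (norm (y - yb)))"

definition metric_subreg_with ::
  "('a::real_normed_vector \<Rightarrow> 'b::real_normed_vector set) \<Rightarrow> 'a \<Rightarrow> 'b \<Rightarrow> real \<Rightarrow> bool" where
  "metric_subreg_with F xb yb \<gamma> \<longleftrightarrow>
    (\<exists>\<delta>>0. \<forall>x\<in>cball xb \<delta>. ennreal \<gamma> * set_dist x (inv_map F yb) \<le> set_dist yb (F x))"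

definition metric_reg_with ::
  "('a::real_normed_vector \<Rightarrow> 'b::real_normed_vector set) \<Rightarrow> 'a \<Rightarrow> 'b \<Rightarrow> real \<Rightarrow> bool" where
  "metric_reg_with F xb yb \<gamma> \<longleftrightarrow>
    (\<exists>\<delta>>0. \<forall>x y. MaxPair x y \<in> cball (MaxPair xb yb) \<delta> \<longrightarrow>
      ennreal \<gamma> * set_dist x (inv_map F y) \<le> set_dist y (F x))"

definition metrically_semiregular ::
  "('a::real_normed_vector \<Rightarrow> 'b::real_normed_vector set) \<Rightarrow> 'a \<Rightarrow> 'b \<Rightarrow> bool" where
  "metrically_semiregular F xb yb \<longleftrightarrow> (\<exists>\<gamma>>0. metric_semireg_with F xb yb \<gamma>)"

definition metrically_subregular ::
  "('a::real_normed_vector \<Rightarrow> 'b::real_normed_vector set) \<Rightarrow> 'a \<Rightarrow> 'b \<Rightarrow> bool" where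
  "metrically_subregular F xb yb \<longleftrightarrow> (\<exists>\<gamma>>0. metric_subreg_with F xb yb \<gamma>)"

definition metrically_regular ::
  "('a::real_normed_vector \<Rightarrow> 'b::real_normed_vector set) \<Rightarrow> 'a \<Rightarrow> 'b \<Rightarrow> bool" where
  "metrically_regular F xb yb \<longleftrightarrow> (\<exists>\<gamma>>0. metric_reg_with F xb yb \<gamma>)"

text \<open>In \<^typ>\<open>ennreal\<close> the supremum of the empty set is \<open>0\<close>, as wanted when no \<open>\<gamma> > 0\<close> works.\<close>

definition map_theta ::
  "('a::real_normed_vector \<Rightarrow> 'b::real_normed_vector set) \<Rightarrow> 'a \<Rightarrow> 'b \<Rightarrow> ennreal" where
  "map_theta F xb yb = (SUP \<gamma>\<in>{\<gamma>. 0 < \<gamma> \<and> metric_semireg_with F xb yb \<gamma>}. ennreal \<gamma>)"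

definition map_zeta ::
  "('a::real_normed_vector \<Rightarrow> 'b::real_normed_vector set) \<Rightarrow> 'a \<Rightarrow> 'b \<Rightarrow> ennreal" where
  "map_zeta F xb yb = (SUP \<gamma>\<in>{\<gamma>. 0 < \<gamma> \<and> metric_subreg_with F xb yb \<gamma>}. ennreal \<gamma>)"

definition map_theta_hat ::
  "('a::real_normed_vector \<Rightarrow> 'b::real_normed_vector set) \<Rightarrow> 'a \<Rightarrow> 'b \<Rightarrow> ennreal" where
  "map_theta_hat F xb yb = (SUP \<gamma>\<in>{\<gamma>. 0 < \<gamma> \<and> metric_reg_with F xb yb \<gamma>}. ennreal \<gamma>)"


section \<open>Regularity of collections of sets\<close>

text \<open>A collection \<open>\<Omega>\<^sub>1, \<dots>, \<Omega>\<^sub>m\<close> is given by its length \<open>m\<close> and a function \<open>\<Omega>\<close> of which only the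
  values at \<open>1, \<dots>, m\<close> are used; likewise for the families \<open>z\<close> and \<open>\<omega>\<close> of points.\<close>

definition translate :: "'z::real_normed_vector set \<Rightarrow> 'z \<Rightarrow> 'z set" where
  "translate S z = (\<lambda>s. s - z) ` S"

definition semiregular :: "nat \<Rightarrow> (nat \<Rightarrow> 'z::real_normed_vector set) \<Rightarrow> 'z \<Rightarrow> bool" where
  "semiregular m \<Omega> zb \<longleftrightarrow>
    (\<exists>\<alpha>>0. \<exists>\<delta>>0. \<forall>\<rho>\<in>{0<..<\<delta>}. \<forall>z. (\<forall>i\<in>{1..m}. norm (z i) \<le> \<alpha> * \<rho>) \<longrightarrow>
      (\<Inter>i\<in>{1..m}. translate (\<Omega> i) (z i)) \<inter> cball zb \<rho> \<noteq> {})"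

definition subregular :: "nat \<Rightarrow> (nat \<Rightarrow> 'z::real_normed_vector set) \<Rightarrow> 'z \<Rightarrow> bool" where
  "subregular m \<Omega> zb \<longleftrightarrow>
    (\<exists>\<alpha>>0. \<exists>\<delta>>0. \<forall>\<rho>\<in>{0<..<\<delta>}.
      (\<Inter>i\<in>{1..m}. \<Omega> i + cball 0 (\<alpha> * \<rho>)) \<inter> cball zb \<delta> \<subseteq> (\<Inter>i\<in>{1..m}. \<Omega> i) + cball 0 \<rho>)"

definition uniformly_regular :: "nat \<Rightarrow> (nat \<Rightarrow> 'z::real_normed_vector set) \<Rightarrow> 'z \<Rightarrow> bool" where
  "uniformly_regular m \<Omega> zb \<longleftrightarrow>
    (\<exists>\<alpha>>0. \<exists>\<delta>>0. \<forall>\<rho>\<in>{0<..<\<delta>}. \<forall>\<omega>. (\<forall>i\<in>{1..m}. \<omega> i \<in> \<Omega> i \<inter> cball zb \<delta>) \<longrightarrow>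
      (\<forall>z. (\<forall>i\<in>{1..m}. norm (z i) \<le> \<alpha> * \<rho>) \<longrightarrow>
        (\<Inter>i\<in>{1..m}. translate (translate (\<Omega> i) (\<omega> i)) (z i)) \<inter> cball 0 \<rho> \<noteq> {}))"

definition theta_rho :: "nat \<Rightarrow> (nat \<Rightarrow> 'z::real_normed_vector set) \<Rightarrow> 'z \<Rightarrow> real \<Rightarrow> ennreal" where
  "theta_rho m \<Omega> zb \<rho> =
    (SUP r\<in>{r. 0 \<le> r \<and> (\<forall>z. (\<forall>i\<in>{1..m}. z i \<in> cball 0 r) \<longrightarrow>
      (\<Inter>i\<in>{1..m}. translate (\<Omega> i) (z i)) \<inter> cball zb \<rho> \<noteq> {})}. ennreal r)"

definition zeta_rho_delta ::
  "nat \<Rightarrow> (nat \<Rightarrow> 'z::real_normed_vector set) \<Rightarrow> 'z \<Rightarrow> real \<Rightarrow> real \<Rightarrow> ennreal" where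
  "zeta_rho_delta m \<Omega> zb \<rho> \<delta> =
    (SUP r\<in>{r. 0 \<le> r \<and>
      (\<Inter>i\<in>{1..m}. \<Omega> i + cball 0 r) \<inter> cball zb \<delta> \<subseteq> (\<Inter>i\<in>{1..m}. \<Omega> i) + cball 0 \<rho>}. ennreal r)"

definition coll_theta :: "nat \<Rightarrow> (nat \<Rightarrow> 'z::real_normed_vector set) \<Rightarrow> 'z \<Rightarrow> ennreal" where
  "coll_theta m \<Omega> zb = Liminf (at_right 0) (\<lambda>\<rho>. theta_rho m \<Omega> zb \<rho> / ennreal \<rho>)"

definition coll_zeta :: "nat \<Rightarrow> (nat \<Rightarrow> 'z::real_normed_vector set) \<Rightarrow> 'z \<Rightarrow> ennreal" where
  "coll_zeta m \<Omega> zb =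
    Lim (at_right 0) (\<lambda>\<delta>. INF \<rho>\<in>{0<..<\<delta>}. zeta_rho_delta m \<Omega> zb \<rho> \<delta> / ennreal \<rho>)"

text \<open>The filter of \<open>\<omega>\<^sub>i \<rightarrow> z\<close>, \<open>\<omega>\<^sub>i \<in> \<Omega>\<^sub>i\<close> for \<open>i = 1, \<dots>, m\<close>; the value \<open>\<omega>\<^sub>i = z\<close> is allowed.\<close>

definition points_tendsto ::
  "nat \<Rightarrow> (nat \<Rightarrow> 'z::real_normed_vector set) \<Rightarrow> 'z \<Rightarrow> (nat \<Rightarrow> 'z) filter" where
  "points_tendsto m \<Omega> zb =
    (INF i\<in>{1..m}. filtercomap (\<lambda>\<omega>. \<omega> i) (inf (nhds zb) (principal (\<Omega> i))))"

definition coll_theta_hat :: "nat \<Rightarrow> (nat \<Rightarrow> 'z::real_normed_vector set) \<Rightarrow> 'z \<Rightarrow> ennreal" where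
  "coll_theta_hat m \<Omega> zb =
    Liminf (points_tendsto m \<Omega> zb \<times>\<^sub>F at_right 0)
      (\<lambda>(\<omega>, \<rho>). theta_rho m (\<lambda>i. translate (\<Omega> i) (\<omega> i)) 0 \<rho> / ennreal \<rho>)"

text \<open>The quotient \<open>t / (t + 2)\<close>, read as \<open>1\<close> for \<open>t = \<infinity>\<close> (where \<^typ>\<open>ennreal\<close> division gives \<open>0\<close>).\<close>

definition frac2 :: "ennreal \<Rightarrow> ennreal" where
  "frac2 t = (if t = \<infinity> then 1 else t / (t + 2))"

end

theory Submission
  imports Defs
begin

text \<open>Each of the six constants is the supremum of the rates for which the corresponding property
  holds, so it suffices to convert rates: a metric rate \<open>\<gamma>\<close> yields for \<open>\<gamma>' < \<gamma>\<close> the rate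
  \<open>\<gamma>' / (\<gamma>' + 2)\<close> of the pair of sets, and a rate \<open>\<alpha>\<close> of the pair yields the metric rate \<open>2 \<alpha>\<close>.
  Shifts by at most \<open>r\<close> of the graph and of the horizontal subspace change the right-hand side \<open>y\<close>
  by at most \<open>2 r\<close>, and each \<open>w\<close> with \<open>\<parallel>w\<parallel> \<le> 2 r\<close> arises as such a change by splitting it
  into two halves; the shift of the graph in the \<open>x\<close> direction costs another \<open>r\<close>, so that \<open>r + 2 r / \<gamma>' = \<rho>\<close>.\<close>

section \<open>Constants as suprema of admissible rates\<close>

text \<open>The supremum need not be attained, hence the strict inequality: some admissible
  \<open>r\<close> exceeds \<open>c * h\<close>, and \<open>anti\<close> carries \<open>Q\<close>
  down to \<open>c * h\<close> itself.\<close>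

lemma rate_less_SUP:
  fixes Q :: "real \<Rightarrow> bool"
  assumes anti: "\<And>r r'. Q r \<Longrightarrow> r' \<le> r \<Longrightarrow> Q r'" and h: "0 < h" and c: "0 \<le> c"
    and less: "ennreal c < (SUP r\<in>{r. 0 \<le> r \<and> Q r}. ennreal r) / ennreal h"
  shows "Q (c * h)"
proof -
  have "ennreal c * ennreal h < (SUP r\<in>{r. 0 \<le> r \<and> Q r}. ennreal r)"
  proof (rule ccontr)
    assume "\<not> ?thesis"
    then have "(SUP r\<in>{r. 0 \<le> r \<and> Q r}. ennreal r) / ennreal h \<le> ennreal c"
      using h by (intro divide_le_posI_ennreal) (auto simp: not_less mult.commute)
    with less show False
      by simp
  qed
  then obtain r where r: "0 \<le> r" "Q r" "ennreal c * ennreal h < ennreal r"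
    by (auto simp: less_SUP_iff)
  then have "c * h < r"
    using c h by (simp add: ennreal_mult[symmetric] ennreal_less_iff)
  with r(2) anti show ?thesis
    by (meson less_imp_le)
qed

lemma rate_le_SUP:
  fixes Q :: "real \<Rightarrow> bool"
  assumes "Q (c * h)" and h: "0 < h" and c: "0 \<le> c"
  shows "ennreal c \<le> (SUP r\<in>{r. 0 \<le> r \<and> Q r}. ennreal r) / ennreal h"
proof -
  have "ennreal (c * h) \<le> (SUP r\<in>{r. 0 \<le> r \<and> Q r}. ennreal r)"
    using assms by (intro SUP_upper) auto
  then have "ennreal (c * h) / ennreal h \<le> (SUP r\<in>{r. 0 \<le> r \<and> Q r}. ennreal r) / ennreal h"
    by (rule divide_right_mono_ennreal)
  then show ?thesis
    using h c by (simp add: divide_ennreal)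
qed

text \<open>Contradictions between two values in \<open>ennreal\<close> can then be run with a
  positive real rate: a value strictly in between is finite because of \<open>b\<close> and positive
  because of \<open>a\<close>.\<close>

lemma less_ennreal_dense_real:
  fixes a b :: ennreal
  assumes "a < b"
  obtains c where "0 < c" "a < ennreal c" "ennreal c < b"
proof -
  obtain d where d: "a < d" "d < b"
    using assms dense by blast
  then have "d \<noteq> top"
    by auto
  then obtain c where "d = ennreal c" "0 \<le> c"
    by (cases d) auto
  moreover have "0 < d"
    using d(1) by (metis gr_zeroI not_less_zero)
  ultimately show ?thesis
    using d that by simp
qed

text \<open>A rate strictly below the \<open>Liminf\<close> is eventually below the quotient, hence
  admissible; an admissible rate is eventually a lower bound of the quotient. The filter is
  arbitrary, so it can be \<open>at_right 0\<close> or its product with the filter of base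
  points.\<close>

lemma Liminf_rate_eq_SUP:
  fixes Q :: "'i \<Rightarrow> real \<Rightarrow> bool" and h :: "'i \<Rightarrow> real"
  assumes anti: "\<And>i r r'. Q i r \<Longrightarrow> r' \<le> r \<Longrightarrow> Q i r'"
    and h: "\<forall>\<^sub>F i in G. 0 < h i"
  shows "Liminf G (\<lambda>i. (SUP r\<in>{r. 0 \<le> r \<and> Q i r}. ennreal r) / ennreal (h i)) =
    (SUP \<alpha>\<in>{\<alpha>. 0 < \<alpha> \<and> (\<forall>\<^sub>F i in G. Q i (\<alpha> * h i))}. ennreal \<alpha>)"
    (is "Liminf G ?f = ?S")
proof (rule antisym)
  show "Liminf G ?f \<le> ?S"
  proof (rule ccontr)
    assume "\<not> Liminf G ?f \<le> ?S"
    then obtain c where c: "0 < c" "?S < ennreal c" "ennreal c < Liminf G ?f"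
      by (meson less_ennreal_dense_real not_le)
    have "\<forall>\<^sub>F i in G. ennreal c < ?f i"
      using c(3) less_LiminfD by blast
    then have "\<forall>\<^sub>F i in G. Q i (c * h i)"
      using h
    proof eventually_elim
      case (elim i)
      show ?case
      proof (rule rate_less_SUP)
        show "Q i r'" if "Q i r" "r' \<le> r" for r r'
          using that by (rule anti)
      qed (use elim c(1) in simp_all)
    qed
    then have "ennreal c \<le> ?S"
      using c(1) by (intro SUP_upper) auto
    with c(2) show False
      by simp
  qed
  show "?S \<le> Liminf G ?f"
  proof (rule SUP_least)
    fix \<alpha>
    assume \<alpha>: "\<alpha> \<in> {\<alpha>. 0 < \<alpha> \<and> (\<forall>\<^sub>F i in G. Q i (\<alpha> * h i))}"
    then have "\<forall>\<^sub>F i in G. Q i (\<alpha> * h i)"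
      by simp
    then have "\<forall>\<^sub>F i in G. ennreal \<alpha> \<le> ?f i"
      using h by eventually_elim (use \<alpha> in \<open>intro rate_le_SUP; simp\<close>)
    then show "ennreal \<alpha> \<le> Liminf G ?f"
      by (rule Liminf_bounded)
  qed
qed

section \<open>The quotient \<open>frac2\<close> and the abstract conversion of rates\<close>

lemma frac2_ennreal:
  assumes "0 \<le> t"
  shows "frac2 (ennreal t) = ennreal (t / (t + 2))"
proof -
  have "ennreal t + 2 = ennreal (t + 2)"
    using ennreal_plus[of t 2] assms by simp
  then show ?thesis
    using assms by (simp add: frac2_def divide_ennreal del: ennreal_plus)
qed

text \<open>If \<open>\<gamma> / (\<gamma> + 2) \<le> L < 1\<close>, then \<open>\<gamma> \<le> 2 L / (1 - L)\<close>, which bounds the supremum of all such \<open>\<gamma>\<close>;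
  so \<^const>\<open>frac2\<close> passes to the supremum without continuity.\<close>

lemma frac2_SUP_le:
  fixes L :: ennreal and G :: "real set"
  assumes "\<And>\<gamma>. \<gamma> \<in> G \<Longrightarrow> 0 < \<gamma>"
    and "\<And>\<gamma>. \<gamma> \<in> G \<Longrightarrow> ennreal (\<gamma> / (\<gamma> + 2)) \<le> L"
  shows "frac2 (SUP \<gamma>\<in>G. ennreal \<gamma>) \<le> L"
proof (cases "L < 1")
  case True
  then obtain l where l: "L = ennreal l" "0 \<le> l" "l < 1"
    by (cases L) (auto simp: ennreal_less_one_iff)
  define g where "g = 2 * l / (1 - l)"
  have g: "0 \<le> g" "g / (g + 2) = l"
    using l(2,3) by (auto simp: g_def field_simps)
  have "(SUP \<gamma>\<in>G. ennreal \<gamma>) \<le> ennreal g"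
  proof (rule SUP_least)
    fix \<gamma> assume "\<gamma> \<in> G"
    then have "\<gamma> / (\<gamma> + 2) \<le> l" "0 < \<gamma>"
      using assms l by (auto simp: ennreal_le_iff)
    then show "ennreal \<gamma> \<le> ennreal g"
      using l(3) by (intro ennreal_leI) (simp add: g_def field_simps)
  qed
  then obtain t where t: "(SUP \<gamma>\<in>G. ennreal \<gamma>) = ennreal t" "0 \<le> t" "t \<le> g"
    using g(1) by (cases "SUP \<gamma>\<in>G. ennreal \<gamma>") (auto simp: top_unique ennreal_le_iff)
  have "frac2 (ennreal t) = ennreal (t / (t + 2))"
    using t(2) by (rule frac2_ennreal)
  also have "\<dots> \<le> ennreal (g / (g + 2))"
    using t(2,3) by (intro ennreal_leI) (simp add: field_simps)
  finally show ?thesis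
    using t(1) g(2) l(1) by simp
next
  case False
  \<comment> \<open>For \<open>L\<close> at least 1 it suffices that \<open>frac2\<close> never
    exceeds 1, its value at infinity included.\<close>
  have "frac2 t \<le> 1" for t
  proof (cases t)
    case (real r)
    then have "frac2 t = ennreal (r / (r + 2))"
      by (simp add: frac2_ennreal)
    also have "\<dots> \<le> 1"
      using real by (simp add: ennreal_le_1)
    finally show ?thesis .
  qed (simp add: frac2_def)
  with False show ?thesis
    by (meson leI order_trans)
qed

text \<open>Common core of all three cases: \<open>M\<close> stands for a metric rate,
  \<open>S\<close> for a rate of the pair of sets. The loss from \<open>\<gamma>\<close> to
  \<open>\<gamma>'\<close> in \<open>MS\<close> accounts for distances that are not attained; it
  disappears in the supremum, because every positive \<open>c\<close> below
  \<open>\<gamma> / (\<gamma> + 2)\<close> has the form \<open>\<gamma>' / (\<gamma>' + 2)\<close>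
  with \<open>\<gamma>' < \<gamma>\<close>.\<close>

lemma regularity_rates:
  fixes M S :: "real \<Rightarrow> bool"
  assumes MS: "\<And>\<gamma> \<gamma>'. M \<gamma> \<Longrightarrow> 0 < \<gamma>' \<Longrightarrow> \<gamma>' < \<gamma> \<Longrightarrow> S (\<gamma>' / (\<gamma>' + 2))"
    and SM: "\<And>\<alpha>. 0 < \<alpha> \<Longrightarrow> S \<alpha> \<Longrightarrow> M (2 * \<alpha>)"
  shows "(\<exists>\<gamma>>0. M \<gamma>) \<longleftrightarrow> (\<exists>\<alpha>>0. S \<alpha>)"
    and "frac2 (SUP \<gamma>\<in>{\<gamma>. 0 < \<gamma> \<and> M \<gamma>}. ennreal \<gamma>) \<le> (SUP \<alpha>\<in>{\<alpha>. 0 < \<alpha> \<and> S \<alpha>}. ennreal \<alpha>)"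
    and "(SUP \<alpha>\<in>{\<alpha>. 0 < \<alpha> \<and> S \<alpha>}. ennreal \<alpha>) \<le> (SUP \<gamma>\<in>{\<gamma>. 0 < \<gamma> \<and> M \<gamma>}. ennreal \<gamma>) / 2"
proof -
  let ?A = "SUP \<alpha>\<in>{\<alpha>. 0 < \<alpha> \<and> S \<alpha>}. ennreal \<alpha>"
  show "(\<exists>\<gamma>>0. M \<gamma>) \<longleftrightarrow> (\<exists>\<alpha>>0. S \<alpha>)"
  proof
    assume "\<exists>\<gamma>>0. M \<gamma>"
    then obtain \<gamma> where "0 < \<gamma>" "M \<gamma>"
      by blast
    then have "S ((\<gamma> / 2) / (\<gamma> / 2 + 2))" "0 < (\<gamma> / 2) / (\<gamma> / 2 + 2)"
      using MS[of \<gamma> "\<gamma> / 2"] by auto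
    then show "\<exists>\<alpha>>0. S \<alpha>"
      by blast
  next
    assume "\<exists>\<alpha>>0. S \<alpha>"
    then show "\<exists>\<gamma>>0. M \<gamma>"
      using SM by (metis mult_pos_pos zero_less_numeral)
  qed
  show "frac2 (SUP \<gamma>\<in>{\<gamma>. 0 < \<gamma> \<and> M \<gamma>}. ennreal \<gamma>) \<le> ?A"
  proof (rule frac2_SUP_le)
    fix \<gamma> assume \<gamma>: "\<gamma> \<in> {\<gamma>. 0 < \<gamma> \<and> M \<gamma>}"
    show "ennreal (\<gamma> / (\<gamma> + 2)) \<le> ?A"
    proof (rule ccontr)
      assume "\<not> ennreal (\<gamma> / (\<gamma> + 2)) \<le> ?A"
      then obtain c where c: "0 < c" "?A < ennreal c" "ennreal c < ennreal (\<gamma> / (\<gamma> + 2))"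
        by (meson less_ennreal_dense_real not_le)
      then have less: "c < \<gamma> / (\<gamma> + 2)"
        by (simp add: ennreal_less_iff)
      moreover have "\<gamma> / (\<gamma> + 2) < 1"
        using \<gamma> by simp
      ultimately have "c < 1"
        by linarith
      \<comment> \<open>The solution of \<open>\<gamma>' / (\<gamma>' + 2) = c\<close>, positive
        because \<open>c\<close> lies strictly between 0 and 1.\<close>
      define \<gamma>' where "\<gamma>' = 2 * c / (1 - c)"
      have "0 < \<gamma>'" "\<gamma>' < \<gamma>" "\<gamma>' / (\<gamma>' + 2) = c"
        using c(1) less \<open>c < 1\<close> \<gamma> by (auto simp: \<gamma>'_def field_simps)
      then have "S c"
        using MS[of \<gamma> \<gamma>'] \<gamma> by simp
      then have "ennreal c \<le> ?A"
        using c(1) by (intro SUP_upper) auto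
      with c(2) show False
        by simp
    qed
  qed auto
  show "?A \<le> (SUP \<gamma>\<in>{\<gamma>. 0 < \<gamma> \<and> M \<gamma>}. ennreal \<gamma>) / 2"
  proof (rule SUP_least)
    fix \<alpha> assume "\<alpha> \<in> {\<alpha>. 0 < \<alpha> \<and> S \<alpha>}"
    then have "0 < \<alpha>" "ennreal (2 * \<alpha>) \<le> (SUP \<gamma>\<in>{\<gamma>. 0 < \<gamma> \<and> M \<gamma>}. ennreal \<gamma>)"
      using SM by (auto intro!: SUP_upper)
    then have "ennreal (2 * \<alpha>) / ennreal 2 \<le> (SUP \<gamma>\<in>{\<gamma>. 0 < \<gamma> \<and> M \<gamma>}. ennreal \<gamma>) / ennreal 2"
      by (intro divide_right_mono_ennreal)
    then show "ennreal \<alpha> \<le> (SUP \<gamma>\<in>{\<gamma>. 0 < \<gamma> \<and> M \<gamma>}. ennreal \<gamma>) / 2"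
      using \<open>0 < \<alpha>\<close> by (simp add: divide_ennreal del: ennreal_numeral) simp
  qed
qed

section \<open>Regularity constants of collections\<close>

lemma in_translate_iff: "p \<in> translate S z \<longleftrightarrow> p + z \<in> S"
  unfolding translate_def by (force simp: image_iff algebra_simps)

text \<open>Isolates the condition shared by \<open>semiregular\<close>, \<open>theta_rho\<close>
  and, for translated sets, \<open>uniformly_regular\<close>. The shift bound comes last, so that
  partial application gives a predicate of rates as in \<open>Liminf_rate_eq_SUP\<close>.\<close>

definition shift_meets ::
  "nat \<Rightarrow> (nat \<Rightarrow> 'z::real_normed_vector set) \<Rightarrow> 'z \<Rightarrow> real \<Rightarrow> real \<Rightarrow> bool" where
  "shift_meets m \<Omega> zb \<rho> r \<longleftrightarrow> (\<forall>z. (\<forall>i\<in>{1..m}. norm (z i) \<le> r) \<longrightarrow>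
    (\<Inter>i\<in>{1..m}. translate (\<Omega> i) (z i)) \<inter> cball zb \<rho> \<noteq> {})"

lemma shift_meets_antimono: "shift_meets m \<Omega> zb \<rho> r \<Longrightarrow> r' \<le> r \<Longrightarrow> shift_meets m \<Omega> zb \<rho> r'"
  unfolding shift_meets_def by (meson order_trans)

lemma theta_rho_eq: "theta_rho m \<Omega> zb \<rho> = (SUP r\<in>{r. 0 \<le> r \<and> shift_meets m \<Omega> zb \<rho> r}. ennreal r)"
  by (simp add: theta_rho_def shift_meets_def)

text \<open>Common points correspond under \<open>q \<mapsto> q + zb\<close>. This makes
  semiregularity the special case of constant base points, so that later only translated sets
  centred at 0 have to be studied.\<close>

lemma shift_meets_translate:
  "shift_meets m (\<lambda>i. translate (\<Omega> i) zb) 0 \<rho> r \<longleftrightarrow> shift_meets m \<Omega> zb \<rho> r"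
proof -
  have "((\<Inter>i\<in>{1..m}. translate (translate (\<Omega> i) zb) (z i)) \<inter> cball 0 \<rho> \<noteq> {}) \<longleftrightarrow>
    ((\<Inter>i\<in>{1..m}. translate (\<Omega> i) (z i)) \<inter> cball zb \<rho> \<noteq> {})" (is "?L \<longleftrightarrow> ?R") for z
  proof
    assume ?L
    then obtain q where "\<forall>i\<in>{1..m}. q + z i + zb \<in> \<Omega> i" "norm q \<le> \<rho>"
      by (auto simp: in_translate_iff)
    then have "q + zb \<in> (\<Inter>i\<in>{1..m}. translate (\<Omega> i) (z i)) \<inter> cball zb \<rho>"
      by (auto simp: in_translate_iff dist_norm algebra_simps)
    then show ?R
      by blast
  next
    assume ?R
    then obtain p where "\<forall>i\<in>{1..m}. p + z i \<in> \<Omega> i" "norm (zb - p) \<le> \<rho>"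
      by (auto simp: in_translate_iff dist_norm)
    then have "p - zb \<in> (\<Inter>i\<in>{1..m}. translate (translate (\<Omega> i) zb) (z i)) \<inter> cball 0 \<rho>"
      by (auto simp: in_translate_iff norm_minus_commute algebra_simps)
    then show ?L
      by blast
  qed
  then show ?thesis
    unfolding shift_meets_def by simp
qed

lemma semiregular_iff_eventually:
  "semiregular m \<Omega> zb \<longleftrightarrow> (\<exists>\<alpha>>0. \<forall>\<^sub>F \<rho> in at_right 0. shift_meets m \<Omega> zb \<rho> (\<alpha> * \<rho>))"
  unfolding semiregular_def shift_meets_def eventually_at_right_field
  by (simp add: Ball_def imp_conjL)

lemma coll_theta_eq_SUP:
  "coll_theta m \<Omega> zb =
    (SUP \<alpha>\<in>{\<alpha>. 0 < \<alpha> \<and> (\<forall>\<^sub>F \<rho> in at_right 0. shift_meets m \<Omega> zb \<rho> (\<alpha> * \<rho>))}. ennreal \<alpha>)"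
  unfolding coll_theta_def theta_rho_eq
  by (rule Liminf_rate_eq_SUP)
    (auto intro: shift_meets_antimono eventually_at_right_less)

section \<open>Limits along base points in the sets, and the rates of uniform regularity\<close>

lemma eventually_points_tendsto:
  "eventually P (points_tendsto m \<Omega> zb) \<longleftrightarrow>
    (\<exists>\<delta>>0. \<forall>\<omega>. (\<forall>i\<in>{1..m}. \<omega> i \<in> \<Omega> i \<inter> cball zb \<delta>) \<longrightarrow> P \<omega>)" (is "?L \<longleftrightarrow> ?R")
proof
  assume ?L
  then obtain Q where Q: "\<And>i. i \<in> {1..m} \<Longrightarrow>
      eventually (Q i) (filtercomap (\<lambda>\<omega>. \<omega> i) (inf (nhds zb) (principal (\<Omega> i))))"
    and QP: "\<And>\<omega>. \<forall>i\<in>{1..m}. Q i \<omega> \<Longrightarrow> P \<omega>"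
    unfolding points_tendsto_def eventually_INF_finite[OF finite_atLeastAtMost] by blast
  have "\<exists>d>0. \<forall>\<omega>. \<omega> i \<in> \<Omega> i \<inter> cball zb d \<longrightarrow> Q i \<omega>" if i: "i \<in> {1..m}" for i
  proof -
    obtain R where "eventually R (inf (nhds zb) (principal (\<Omega> i)))" and R: "\<And>\<omega>. R (\<omega> i) \<Longrightarrow> Q i \<omega>"
      using Q[OF i] unfolding eventually_filtercomap by blast
    then obtain d where "0 < d" "\<And>p. dist p zb < d \<Longrightarrow> p \<in> \<Omega> i \<Longrightarrow> R p"
      unfolding eventually_inf_principal eventually_nhds_metric by blast
    \<comment> \<open>Neighbourhoods provide an open ball; half its radius gives a closed ball
      inside it.\<close>
    then show ?thesis
      using R by (intro exI[of _ "d / 2"]) (auto simp: dist_commute)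
  qed
  then obtain d where d: "\<And>i. i \<in> {1..m} \<Longrightarrow> 0 < d i"
      "\<And>i \<omega>. i \<in> {1..m} \<Longrightarrow> \<omega> i \<in> \<Omega> i \<inter> cball zb (d i) \<Longrightarrow> Q i \<omega>"
    by metis
  \<comment> \<open>The extra element 1 keeps the minimum meaningful for
    \<open>m = 0\<close>.\<close>
  define \<delta> where "\<delta> = Min (insert 1 (d ` {1..m}))"
  have "0 < \<delta>"
    using d(1) by (auto simp: \<delta>_def)
  have le: "\<delta> \<le> d i" if "i \<in> {1..m}" for i
    unfolding \<delta>_def using that by (intro Min_le) auto
  show ?R
  proof (intro exI conjI allI impI)
    fix \<omega> assume \<omega>: "\<forall>i\<in>{1..m}. \<omega> i \<in> \<Omega> i \<inter> cball zb \<delta>"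
    have "\<omega> i \<in> \<Omega> i \<inter> cball zb (d i)" if "i \<in> {1..m}" for i
      using \<omega> that subset_cball[OF le[OF that]] by blast
    then show "P \<omega>"
      using d(2) QP by blast
  qed fact
next
  assume ?R
  then obtain \<delta> where \<delta>: "0 < \<delta>" "\<And>\<omega>. \<forall>i\<in>{1..m}. \<omega> i \<in> \<Omega> i \<inter> cball zb \<delta> \<Longrightarrow> P \<omega>"
    by blast
  show ?L
    unfolding points_tendsto_def
  proof (subst eventually_INF_finite, simp, intro exI conjI ballI allI impI)
    fix i assume "i \<in> {1..m}"
    have "\<forall>\<^sub>F p in inf (nhds zb) (principal (\<Omega> i)). p \<in> \<Omega> i \<inter> cball zb \<delta>"
      unfolding eventually_inf_principal eventually_nhds_metric
      using \<delta>(1) by (intro exI[of _ \<delta>]) (auto simp: dist_commute)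
    then show "\<forall>\<^sub>F \<omega> in filtercomap (\<lambda>\<omega>. \<omega> i) (inf (nhds zb) (principal (\<Omega> i))).
        \<omega> i \<in> \<Omega> i \<inter> cball zb \<delta>"
      unfolding eventually_filtercomap by blast
  next
    fix \<omega> assume "\<forall>i\<in>{1..m}. \<omega> i \<in> \<Omega> i \<inter> cball zb \<delta>"
    then show "P \<omega>"
      by (rule \<delta>(2))
  qed
qed

text \<open>The two factors of the product filter come with separate radii; their minimum is the
  single \<open>\<delta>\<close> that bounds both \<open>\<rho>\<close> and the base points in the
  definition of uniform regularity.\<close>

lemma eventually_points_tendsto_at_right:
  "(\<forall>\<^sub>F (\<omega>, \<rho>) in points_tendsto m \<Omega> zb \<times>\<^sub>F at_right (0::real). P \<omega> \<rho>) \<longleftrightarrow>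
    (\<exists>\<delta>>0. \<forall>\<rho>\<in>{0<..<\<delta>}. \<forall>\<omega>. (\<forall>i\<in>{1..m}. \<omega> i \<in> \<Omega> i \<inter> cball zb \<delta>) \<longrightarrow> P \<omega> \<rho>)" (is "?L \<longleftrightarrow> ?R")
proof
  assume ?L
  then obtain A B where A: "eventually A (points_tendsto m \<Omega> zb)" and B: "eventually B (at_right (0::real))"
    and AB: "\<And>\<omega> \<rho>. A \<omega> \<Longrightarrow> B \<rho> \<Longrightarrow> P \<omega> \<rho>"
    unfolding eventually_prod_filter by auto
  obtain d where d: "0 < d" "\<And>\<omega>. \<forall>i\<in>{1..m}. \<omega> i \<in> \<Omega> i \<inter> cball zb d \<Longrightarrow> A \<omega>"
    using A unfolding eventually_points_tendsto by blast
  obtain e where e: "0 < e" "\<And>\<rho>. 0 < \<rho> \<Longrightarrow> \<rho> < e \<Longrightarrow> B \<rho>"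
    using B unfolding eventually_at_right_field by blast
  show ?R
    using d e AB by (intro exI[of _ "min d e"]) auto
next
  assume ?R
  then obtain \<delta> where \<delta>: "0 < \<delta>"
      "\<And>\<rho> \<omega>. 0 < \<rho> \<Longrightarrow> \<rho> < \<delta> \<Longrightarrow> \<forall>i\<in>{1..m}. \<omega> i \<in> \<Omega> i \<inter> cball zb \<delta> \<Longrightarrow> P \<omega> \<rho>"
    by auto
  have "\<forall>\<^sub>F \<omega> in points_tendsto m \<Omega> zb. \<forall>i\<in>{1..m}. \<omega> i \<in> \<Omega> i \<inter> cball zb \<delta>"
    unfolding eventually_points_tendsto using \<delta>(1) by blast
  moreover have "\<forall>\<^sub>F \<rho> in at_right (0::real). 0 < \<rho> \<and> \<rho> < \<delta>"
    unfolding eventually_at_right_field using \<delta>(1) by blast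
  ultimately show ?L
    unfolding eventually_prod_filter using \<delta>(2) by (simp add: case_prod_unfold) blast
qed

lemma uniformly_regular_iff_eventually:
  "uniformly_regular m \<Omega> zb \<longleftrightarrow> (\<exists>\<alpha>>0. \<exists>\<delta>>0. \<forall>\<rho>\<in>{0<..<\<delta>}. \<forall>\<omega>.
    (\<forall>i\<in>{1..m}. \<omega> i \<in> \<Omega> i \<inter> cball zb \<delta>) \<longrightarrow>
    shift_meets m (\<lambda>i. translate (\<Omega> i) (\<omega> i)) 0 \<rho> (\<alpha> * \<rho>))"
  unfolding uniformly_regular_def shift_meets_def ..

text \<open>An instance of \<open>Liminf_rate_eq_SUP\<close> whose index is the pair of base points
  and radius, with \<open>h\<close> the second projection.\<close>

lemma coll_theta_hat_eq_SUP:
  "coll_theta_hat m \<Omega> zb = (SUP \<alpha>\<in>{\<alpha>. 0 < \<alpha> \<and> (\<exists>\<delta>>0. \<forall>\<rho>\<in>{0<..<\<delta>}. \<forall>\<omega>.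
    (\<forall>i\<in>{1..m}. \<omega> i \<in> \<Omega> i \<inter> cball zb \<delta>) \<longrightarrow>
    shift_meets m (\<lambda>i. translate (\<Omega> i) (\<omega> i)) 0 \<rho> (\<alpha> * \<rho>))}. ennreal \<alpha>)"
proof -
  let ?G = "points_tendsto m \<Omega> zb \<times>\<^sub>F at_right (0::real)"
  let ?Q = "\<lambda>(\<omega>, \<rho>). shift_meets m (\<lambda>i. translate (\<Omega> i) (\<omega> i)) 0 \<rho>"
  have rate: "(\<forall>\<^sub>F p in ?G. ?Q p (\<alpha> * snd p)) \<longleftrightarrow> (\<exists>\<delta>>0. \<forall>\<rho>\<in>{0<..<\<delta>}. \<forall>\<omega>.
    (\<forall>i\<in>{1..m}. \<omega> i \<in> \<Omega> i \<inter> cball zb \<delta>) \<longrightarrow>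
    shift_meets m (\<lambda>i. translate (\<Omega> i) (\<omega> i)) 0 \<rho> (\<alpha> * \<rho>))" for \<alpha>
    by (subst eventually_points_tendsto_at_right[symmetric]) (simp add: case_prod_unfold)
  have "coll_theta_hat m \<Omega> zb =
    Liminf ?G (\<lambda>p. (SUP r\<in>{r. 0 \<le> r \<and> ?Q p r}. ennreal r) / ennreal (snd p))"
    unfolding coll_theta_hat_def theta_rho_eq by (simp add: case_prod_unfold)
  also have "\<dots> = (SUP \<alpha>\<in>{\<alpha>. 0 < \<alpha> \<and> (\<forall>\<^sub>F p in ?G. ?Q p (\<alpha> * snd p))}. ennreal \<alpha>)"
  proof (rule Liminf_rate_eq_SUP)
    have "\<forall>\<^sub>F (\<omega>, \<rho>) in ?G. 0 < \<rho>"
      unfolding eventually_points_tendsto_at_right by (auto intro: exI[of _ 1])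
    then show "\<forall>\<^sub>F p in ?G. 0 < snd p"
      by (simp add: case_prod_unfold)
  qed (auto intro: shift_meets_antimono)
  finally show ?thesis
    unfolding rate .
qed

section \<open>Fattened sets and the rates of subregularity\<close>

definition fattening_in ::
  "nat \<Rightarrow> (nat \<Rightarrow> 'z::real_normed_vector set) \<Rightarrow> 'z \<Rightarrow> real \<Rightarrow> real \<Rightarrow> real \<Rightarrow> bool" where
  "fattening_in m \<Omega> zb \<delta> \<rho> r \<longleftrightarrow>
    (\<Inter>i\<in>{1..m}. \<Omega> i + cball 0 r) \<inter> cball zb \<delta> \<subseteq> (\<Inter>i\<in>{1..m}. \<Omega> i) + cball 0 \<rho>"

lemma fattening_in_antimono:
  assumes "fattening_in m \<Omega> zb \<delta> \<rho> r" "r' \<le> r" "\<delta>' \<le> \<delta>"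
  shows "fattening_in m \<Omega> zb \<delta>' \<rho> r'"
proof -
  have "\<Omega> i + cball 0 r' \<subseteq> \<Omega> i + cball 0 r" for i
    by (intro set_plus_mono2 subset_cball assms) simp
  moreover have "cball zb \<delta>' \<subseteq> cball zb \<delta>"
    by (rule subset_cball) fact
  ultimately show ?thesis
    using assms(1) unfolding fattening_in_def by blast
qed

lemma subregular_iff_fattening_in:
  "subregular m \<Omega> zb \<longleftrightarrow> (\<exists>\<alpha>>0. \<exists>\<delta>>0. \<forall>\<rho>\<in>{0<..<\<delta>}. fattening_in m \<Omega> zb \<delta> \<rho> (\<alpha> * \<rho>))"
  unfolding subregular_def fattening_in_def ..

text \<open>Here \<open>\<delta>\<close> bounds \<open>\<rho>\<close> and is also the radius of the
  ball, so the limit is computed directly. A rate strictly below the infimum for some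
  \<open>\<delta>\<close> is admissible with that same \<open>\<delta>\<close>, so no infimum
  exceeds the supremum; an admissible rate with \<open>\<delta>\<close> bounds the infima for all
  smaller radii from below. Convergence has to be proved because \<open>Lim\<close> is a definite
  description.\<close>

lemma coll_zeta_eq_SUP:
  "coll_zeta m \<Omega> zb =
    (SUP \<alpha>\<in>{\<alpha>. 0 < \<alpha> \<and> (\<exists>\<delta>>0. \<forall>\<rho>\<in>{0<..<\<delta>}. fattening_in m \<Omega> zb \<delta> \<rho> (\<alpha> * \<rho>))}. ennreal \<alpha>)"
    (is "_ = ?S")
proof -
  let ?f = "\<lambda>\<delta>. INF \<rho>\<in>{0<..<\<delta>}. zeta_rho_delta m \<Omega> zb \<rho> \<delta> / ennreal \<rho>"
  have zeta: "zeta_rho_delta m \<Omega> zb \<rho> \<delta> =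
      (SUP r\<in>{r. 0 \<le> r \<and> fattening_in m \<Omega> zb \<delta> \<rho> r}. ennreal r)" for \<rho> \<delta>
    by (simp add: zeta_rho_delta_def fattening_in_def)
  have upper: "?f \<delta> \<le> ?S" if "0 < \<delta>" for \<delta>
  proof (rule ccontr)
    assume "\<not> ?f \<delta> \<le> ?S"
    then obtain c where c: "0 < c" "?S < ennreal c" "ennreal c < ?f \<delta>"
      by (meson less_ennreal_dense_real not_le)
    have "fattening_in m \<Omega> zb \<delta> \<rho> (c * \<rho>)" if "\<rho> \<in> {0<..<\<delta>}" for \<rho>
    proof (rule rate_less_SUP)
      show "ennreal c < (SUP r\<in>{r. 0 \<le> r \<and> fattening_in m \<Omega> zb \<delta> \<rho> r}. ennreal r) / ennreal \<rho>"
        using less_le_trans[OF c(3) INF_lower[OF that]] by (simp add: zeta)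
    qed (use c that in \<open>auto intro: fattening_in_antimono\<close>)
    then have "ennreal c \<le> ?S"
      using c(1) \<open>0 < \<delta>\<close> by (intro SUP_upper) auto
    with c(2) show False
      by simp
  qed
  have "(?f \<longlongrightarrow> ?S) (at_right 0)"
  proof (rule order_tendstoI)
    fix a assume "a < ?S"
    then obtain \<alpha> \<delta> where \<alpha>: "0 < \<alpha>" "a < ennreal \<alpha>" "0 < \<delta>"
        "\<And>\<rho>. 0 < \<rho> \<Longrightarrow> \<rho> < \<delta> \<Longrightarrow> fattening_in m \<Omega> zb \<delta> \<rho> (\<alpha> * \<rho>)"
      by (auto simp: less_SUP_iff)
    have "a < ?f d" if d: "0 < d" "d < \<delta>" for d
    proof -
      have "ennreal \<alpha> \<le> ?f d"
      proof (rule INF_greatest)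
        fix \<rho> assume "\<rho> \<in> {0<..<d}"
        then show "ennreal \<alpha> \<le> zeta_rho_delta m \<Omega> zb \<rho> d / ennreal \<rho>"
          unfolding zeta using \<alpha> d
          by (intro rate_le_SUP fattening_in_antimono[OF \<alpha>(4)[of \<rho>]]) auto
      qed
      with \<alpha>(2) show ?thesis
        by (rule less_le_trans)
    qed
    then show "\<forall>\<^sub>F d in at_right 0. a < ?f d"
      unfolding eventually_at_right_field using \<alpha>(3) by blast
  next
    fix a assume "?S < a"
    then have "?f d < a" if "0 < d" for d
      using upper[OF that] by (rule le_less_trans[rotated])
    then show "\<forall>\<^sub>F d in at_right 0. ?f d < a"
      unfolding eventually_at_right_field by (intro exI[of _ 1]) auto
  qed
  then show ?thesis
    unfolding coll_zeta_def by (intro tendsto_Lim) auto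
qed

section \<open>The graph of a mapping and a horizontal subspace\<close>

lemma max_prod_norm_le_iff: "norm p \<le> r \<longleftrightarrow> norm (mfst p) \<le> r \<and> norm (msnd p) \<le> r"
  by (simp add: norm_max_prod_def)

lemma max_prod_sel [simp]:
  "mfst (p + q) = mfst p + mfst q" "msnd (p + q) = msnd p + msnd q"
  "mfst (p - q) = mfst p - mfst q" "msnd (p - q) = msnd p - msnd q"
  by (simp_all add: plus_max_prod_def minus_max_prod_def)

lemma max_prod_cball_iff:
  "MaxPair x y \<in> cball (MaxPair a b) r \<longleftrightarrow> norm (a - x) \<le> r \<and> norm (b - y) \<le> r"
  by (simp add: dist_norm max_prod_norm_le_iff)

lemma in_gph_iff: "p \<in> gph F \<longleftrightarrow> msnd p \<in> F (mfst p)"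
  by (cases p) (auto simp: gph_def)

section \<open>Passing between distance estimates and nearby points\<close>

lemma mult_set_dist_le:
  assumes "s \<in> S" "\<gamma> * norm (x - s) \<le> b" "0 \<le> \<gamma>"
  shows "ennreal \<gamma> * set_dist x S \<le> ennreal b"
proof -
  have "ennreal \<gamma> * set_dist x S \<le> ennreal \<gamma> * ennreal (norm (x - s))"
    unfolding set_dist_def by (intro mult_left_mono INF_lower assms) simp
  also have "\<dots> \<le> ennreal b"
    using assms by (simp add: ennreal_mult[symmetric] ennreal_leI)
  finally show ?thesis .
qed

text \<open>If no point of \<open>S\<close> were within \<open>c\<close>, in particular if
  \<open>S\<close> were empty, the distance would be at least \<open>c\<close>. The strict bound on
  \<open>b\<close> is the slack that makes up for an infimum that is not attained.\<close>

lemma set_dist_obtain_near: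
  assumes "ennreal \<gamma> * set_dist x S \<le> ennreal b" "b < \<gamma> * c" "0 < c" "0 < \<gamma>"
  obtains s where "s \<in> S" "norm (x - s) \<le> c"
proof (rule ccontr)
  assume "\<not> thesis"
  with that have "\<And>s. s \<in> S \<Longrightarrow> c \<le> norm (x - s)"
    by (meson linear)
  then have "ennreal c \<le> set_dist x S"
    unfolding set_dist_def by (intro INF_greatest ennreal_leI)
  then have "ennreal \<gamma> * ennreal c \<le> ennreal \<gamma> * set_dist x S"
    by (intro mult_left_mono) auto
  with assms(1) have "ennreal (\<gamma> * c) \<le> ennreal b"
    using assms(3,4) by (simp add: ennreal_mult)
  then show False
    using assms(2-4) by (metis ennreal_le_iff2 mult_pos_pos not_less)
qed

text \<open>What remains of regularity of the pair of sets at \<open>(x, y) \<in> gph F\<close> once the shifts in the \<open>y\<close>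
  direction have been combined into \<open>w\<close> and the horizontal shift of the subspace has been dropped.\<close>

definition hits ::
  "('a::real_normed_vector \<Rightarrow> 'b::real_normed_vector set) \<Rightarrow> 'a \<Rightarrow> 'b \<Rightarrow> real \<Rightarrow> real \<Rightarrow> bool" where
  "hits F x y \<rho> r \<longleftrightarrow> (\<forall>a w. norm a \<le> r \<longrightarrow> norm w \<le> 2 * r \<longrightarrow>
    (\<exists>x'. y + w \<in> F x' \<and> norm (x' - x - a) \<le> \<rho>))"

text \<open>The origin of the quotient: \<open>g / (g + 2) * \<rho>\<close> is the solution
  \<open>r\<close> of \<open>2 * r / g + r = \<rho>\<close>.\<close>

lemma rate_split:
  fixes g :: real
  assumes "0 < g"
  shows "2 * (g / (g + 2) * \<rho>) / g + g / (g + 2) * \<rho> = \<rho>"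
proof -
  have "2 * (g / (g + 2) * \<rho>) / g = 2 * \<rho> / (g + 2)"
    using assms by simp
  then show ?thesis
    using assms by (simp add: field_simps)
qed

text \<open>The metric estimate yields a solution within \<open>2 * r / \<gamma>'\<close> of
  \<open>x\<close>, the horizontal shift \<open>a\<close> costs another \<open>r\<close>, and by
  \<open>rate_split\<close> these add up to \<open>\<rho>\<close>. Bounding the distance by
  \<open>norm w\<close> covers both semiregularity and regularity.\<close>

lemma hits_of_set_dist_le:
  fixes F :: "'a::real_normed_vector \<Rightarrow> 'b::real_normed_vector set"
  assumes "\<And>w. norm w \<le> 2 * (\<gamma>' / (\<gamma>' + 2) * \<rho>) \<Longrightarrow>
      ennreal \<gamma> * set_dist x (inv_map F (y + w)) \<le> ennreal (norm w)"
    and "y \<in> F x" "0 < \<gamma>'" "\<gamma>' < \<gamma>" "0 < \<rho>"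
  shows "hits F x y \<rho> (\<gamma>' / (\<gamma>' + 2) * \<rho>)"
  unfolding hits_def
proof (intro allI impI)
  fix a :: 'a and w :: 'b
  let ?r = "\<gamma>' / (\<gamma>' + 2) * \<rho>"
  assume a: "norm a \<le> ?r" and w: "norm w \<le> 2 * ?r"
  have r: "0 < ?r" "2 * ?r / \<gamma>' + ?r = \<rho>"
    using assms rate_split by auto
  have "norm w \<le> \<gamma>' * (2 * ?r / \<gamma>')"
    using w assms(3) by (simp add: mult_ac)
  \<comment> \<open>The gap between \<open>\<gamma>'\<close> and \<open>\<gamma>\<close> supplies
    the strictness that \<open>set_dist_obtain_near\<close> requires.\<close>
  also have "\<dots> < \<gamma> * (2 * ?r / \<gamma>')"
    using assms(3-5) by (intro mult_strict_right_mono) auto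
  finally have "norm w < \<gamma> * (2 * ?r / \<gamma>')" .
  moreover have "0 < 2 * ?r / \<gamma>'" "0 < \<gamma>"
    using assms(3-5) by auto
  ultimately obtain x' where x': "x' \<in> inv_map F (y + w)" "norm (x - x') \<le> 2 * ?r / \<gamma>'"
    using assms(1)[OF w] set_dist_obtain_near by blast
  have "norm (x' - x - a) \<le> norm (x - x') + norm a"
    by (metis norm_minus_commute norm_triangle_ineq4)
  then have "norm (x' - x - a) \<le> \<rho>"
    using x'(2) a r(2) by linarith
  then show "\<exists>x'. y + w \<in> F x' \<and> norm (x' - x - a) \<le> \<rho>"
    using x'(1) by (auto simp: inv_map_def)
qed

lemma hits_solution:
  fixes F :: "'a::real_normed_vector \<Rightarrow> 'b::real_normed_vector set"
  assumes "\<And>\<rho>. 0 < \<rho> \<Longrightarrow> \<rho> < \<delta> \<Longrightarrow> hits F x y \<rho> (\<alpha> * \<rho>)"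
    and "y \<in> F x" "0 < \<alpha>" "norm w < 2 * \<alpha> * \<delta>"
  obtains x' where "x' \<in> inv_map F (y + w)" "2 * \<alpha> * norm (x - x') \<le> norm w"
proof (cases "w = 0")
  case True
  then show ?thesis
    using assms(2) that[of x] by (simp add: inv_map_def)
next
  case False
  \<comment> \<open>With this radius \<open>w\<close> is as large as \<open>hits\<close> allows, and
    the horizontal shift can be taken to be 0. For \<open>w = 0\<close> the radius would not be
    positive, which is why that case is separate.\<close>
  define \<rho> where "\<rho> = norm w / (2 * \<alpha>)"
  have "0 < \<rho>" "\<rho> < \<delta>" "norm w = 2 * (\<alpha> * \<rho>)" "norm (0::'a) \<le> \<alpha> * \<rho>"
    using False assms(3,4) by (auto simp: \<rho>_def field_simps)
  then obtain x' where "y + w \<in> F x'" "norm (x' - x - 0) \<le> \<rho>"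
    using assms(1)[of \<rho>] unfolding hits_def by (metis order_refl)
  moreover from this have "2 * \<alpha> * norm (x - x') \<le> norm w"
    using assms(3) by (simp add: \<rho>_def field_simps norm_minus_commute)
  ultimately show ?thesis
    using that by (simp add: inv_map_def)
qed

section \<open>Componentwise form of the set conditions for the graph and the level set\<close>

lemma ball_1_2: "(\<forall>i\<in>{1..2::nat}. P i) \<longleftrightarrow> P 1 \<and> P 2"
proof -
  have "{1..2::nat} = {1, 2}"
    by auto
  then show ?thesis
    by simp
qed

locale graph_and_level =
  fixes F :: "'a::real_normed_vector \<Rightarrow> 'b::real_normed_vector set"
    and xb :: 'a and yb :: 'b
    and \<Omega> :: "nat \<Rightarrow> ('a, 'b) max_prod set"
  assumes base: "MaxPair xb yb \<in> gph F"
    and \<Omega>1: "\<Omega> 1 = gph F"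
    and \<Omega>2: "\<Omega> 2 = {MaxPair x yb | x. x \<in> UNIV}"
begin

lemma in_\<Omega>2_iff: "p \<in> \<Omega> 2 \<longleftrightarrow> msnd p = yb"
  by (cases p) (auto simp: \<Omega>2)

lemma yb_in: "yb \<in> F xb"
  using base by (simp add: in_gph_iff)

text \<open>Trades the indexed family of shifts for two independent points; the base points are
  carried along so that semiregularity and uniform regularity share this form.\<close>

lemma shift_meets_iff:
  "shift_meets 2 (\<lambda>i. translate (\<Omega> i) (\<omega> i)) 0 \<rho> r \<longleftrightarrow>
    (\<forall>z1 z2. norm z1 \<le> r \<longrightarrow> norm z2 \<le> r \<longrightarrow>
      (\<exists>p. p + z1 + \<omega> 1 \<in> gph F \<and> msnd (p + z2 + \<omega> 2) = yb \<and> norm p \<le> \<rho>))" (is "?L \<longleftrightarrow> ?R")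
proof
  assume L: ?L
  show ?R
  proof (intro allI impI)
    fix z1 z2 :: "('a, 'b) max_prod"
    assume "norm z1 \<le> r" "norm z2 \<le> r"
    then have "\<forall>i\<in>{1..2}. norm ((if i = (1::nat) then z1 else z2)) \<le> r"
      by simp
    then obtain p where "p \<in> cball 0 \<rho>"
        "\<forall>i\<in>{1..2}. p \<in> translate (translate (\<Omega> i) (\<omega> i)) (if i = 1 then z1 else z2)"
      using L unfolding shift_meets_def by (auto dest!: spec[of _ "\<lambda>i. if i = 1 then z1 else z2"])
    then show "\<exists>p. p + z1 + \<omega> 1 \<in> gph F \<and> msnd (p + z2 + \<omega> 2) = yb \<and> norm p \<le> \<rho>"
      unfolding ball_1_2 in_translate_iff in_\<Omega>2_iff \<Omega>1 by auto
  qed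
next
  assume R: ?R
  show ?L
    unfolding shift_meets_def ball_1_2
  proof (intro allI impI)
    fix z :: "nat \<Rightarrow> ('a, 'b) max_prod"
    assume "norm (z 1) \<le> r \<and> norm (z 2) \<le> r"
    then obtain p where "p + z 1 + \<omega> 1 \<in> gph F" "msnd (p + z 2 + \<omega> 2) = yb" "norm p \<le> \<rho>"
      using R by blast
    then have "\<forall>i\<in>{1..2}. p \<in> translate (translate (\<Omega> i) (\<omega> i)) (z i)" "p \<in> cball 0 \<rho>"
      unfolding ball_1_2 in_translate_iff in_\<Omega>2_iff \<Omega>1 by auto
    then show "(\<Inter>i\<in>{1..2}. translate (translate (\<Omega> i) (\<omega> i)) (z i)) \<inter> cball 0 \<rho> \<noteq> {}"
      by blast
  qed
qed

text \<open>The level set forces the second component of the common point to be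
  \<open>- msnd z2\<close>, so the graph has to be met at height \<open>msnd (\<omega> 1)\<close>
  changed by \<open>msnd z1 - msnd z2\<close>, of norm at most \<open>2 * r\<close>. The condition
  \<open>r \<le> \<rho>\<close> keeps that second component inside the ball.\<close>

lemma shift_meets_of_hits:
  assumes "hits F (mfst (\<omega> 1)) (msnd (\<omega> 1)) \<rho> r" "r \<le> \<rho>" "msnd (\<omega> 2) = yb"
  shows "shift_meets 2 (\<lambda>i. translate (\<Omega> i) (\<omega> i)) 0 \<rho> r"
  unfolding shift_meets_iff
proof (intro allI impI)
  fix z1 z2 :: "('a, 'b) max_prod"
  assume z: "norm z1 \<le> r" "norm z2 \<le> r"
  have "norm (msnd z1 - msnd z2) \<le> 2 * r"
    using z norm_triangle_ineq4[of "msnd z1" "msnd z2"] unfolding max_prod_norm_le_iff by linarith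
  then obtain x' where x': "msnd (\<omega> 1) + (msnd z1 - msnd z2) \<in> F x'"
      "norm (x' - mfst (\<omega> 1) - mfst z1) \<le> \<rho>"
    using assms(1) z unfolding hits_def max_prod_norm_le_iff by blast
  define p where "p = MaxPair (x' - mfst (\<omega> 1) - mfst z1) (- msnd z2)"
  have "p + z1 + \<omega> 1 \<in> gph F" "msnd (p + z2 + \<omega> 2) = yb" "norm p \<le> \<rho>"
    using x' z assms(2,3) by (auto simp: p_def in_gph_iff max_prod_norm_le_iff algebra_simps)
  then show "\<exists>p. p + z1 + \<omega> 1 \<in> gph F \<and> msnd (p + z2 + \<omega> 2) = yb \<and> norm p \<le> \<rho>"
    by blast
qed

lemma hits_of_shift_meets:
  assumes "shift_meets 2 (\<lambda>i. translate (\<Omega> i) (\<omega> i)) 0 \<rho> r" "msnd (\<omega> 2) = yb"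
  shows "hits F (mfst (\<omega> 1)) (msnd (\<omega> 1)) \<rho> r"
  unfolding hits_def
proof (intro allI impI)
  fix a :: 'a and w :: 'b
  assume "norm a \<le> r" "norm w \<le> 2 * r"
  \<comment> \<open>The shifts \<open>h\<close> of the graph and \<open>- h\<close> of the level set
    force \<open>msnd p = h\<close>, so that the height changes by \<open>h + h = w\<close> in
    total.\<close>
  moreover define h where "h = (1/2) *\<^sub>R w"
  ultimately have "norm (MaxPair a h) \<le> r" "norm (MaxPair 0 (- h) :: ('a, 'b) max_prod) \<le> r"
    using norm_ge_zero[of a] by (auto simp: max_prod_norm_le_iff simp del: norm_ge_zero)
  then obtain p where p: "p + MaxPair a h + \<omega> 1 \<in> gph F"
      "msnd (p + MaxPair 0 (- h) + \<omega> 2) = yb" "norm p \<le> \<rho>"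
    using assms(1) unfolding shift_meets_iff by blast
  have "msnd p = h"
    using p(2) assms(2) by simp
  moreover have "h + h = w"
    unfolding h_def by (simp flip: scaleR_left_distrib)
  ultimately have "msnd p + h + msnd (\<omega> 1) = msnd (\<omega> 1) + w"
    by (simp add: add.commute)
  then show "\<exists>x'. msnd (\<omega> 1) + w \<in> F x' \<and> norm (x' - mfst (\<omega> 1) - a) \<le> \<rho>"
    using p(1,3) by (intro exI[of _ "mfst p + a + mfst (\<omega> 1)"])
      (auto simp: in_gph_iff max_prod_norm_le_iff add_ac)
qed

text \<open>The second component of the common point is forced to be the negative of that of the second
  shift.\<close>

lemma shift_meets_rate_le:
  assumes "shift_meets 2 (\<lambda>i. translate (\<Omega> i) (\<omega> i)) 0 \<rho> r" "msnd (\<omega> 2) = yb" "0 \<le> r"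
    and "(UNIV :: 'b set) \<noteq> {0}"
  shows "r \<le> \<rho>"
proof -
  obtain v :: 'b where "v \<noteq> 0"
    using assms(4) by blast
  define e where "e = r *\<^sub>R sgn v"
  have e: "norm e = r"
    using \<open>v \<noteq> 0\<close> assms(3) by (simp add: e_def norm_sgn)
  have "norm (0 :: ('a, 'b) max_prod) \<le> r" "norm (MaxPair 0 e :: ('a, 'b) max_prod) \<le> r"
    using e assms(3) by (auto simp: max_prod_norm_le_iff)
  then obtain p where "msnd (p + MaxPair 0 e + \<omega> 2) = yb" "norm p \<le> \<rho>"
    using assms(1) unfolding shift_meets_iff by blast
  then have "msnd p = - e" "norm (msnd p) \<le> \<rho>"
    using assms(2) by (auto simp: max_prod_norm_le_iff eq_neg_iff_add_eq_0)
  with e show ?thesis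
    by simp
qed

text \<open>In the maximum norm \<open>MaxPair u yb\<close> is a nearest point of the level set to
  \<open>MaxPair u v\<close>, so closeness to that set only concerns \<open>v\<close>. The
  intersection of the two sets consists of the solutions at height \<open>yb\<close>.\<close>

lemma fattening_in_iff:
  "fattening_in 2 \<Omega> (MaxPair xb yb) \<delta> \<rho> r \<longleftrightarrow>
    (\<forall>u v x y. y \<in> F x \<longrightarrow> norm (u - x) \<le> r \<longrightarrow> norm (v - y) \<le> r \<longrightarrow> norm (v - yb) \<le> r \<longrightarrow>
      norm (xb - u) \<le> \<delta> \<longrightarrow> norm (yb - v) \<le> \<delta> \<longrightarrow>
      norm (v - yb) \<le> \<rho> \<and> (\<exists>x'. yb \<in> F x' \<and> norm (u - x') \<le> \<rho>))"
proof -
  have plus: "p \<in> S + cball 0 r \<longleftrightarrow> (\<exists>q\<in>S. norm (p - q) \<le> r)"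
    for p :: "('a, 'b) max_prod" and S r
  proof
    assume "p \<in> S + cball 0 r"
    then obtain a b where "p = a + b" "a \<in> S" "norm b \<le> r"
      by (auto elim: set_plus_elim)
    then show "\<exists>q\<in>S. norm (p - q) \<le> r"
      by (intro bexI[of _ a]) simp_all
  next
    assume "\<exists>q\<in>S. norm (p - q) \<le> r"
    then obtain q where "q \<in> S" "p - q \<in> cball 0 r"
      by auto
    from set_plus_intro[OF this] show "p \<in> S + cball 0 r"
      by simp
  qed
  have Int: "(\<Inter>i\<in>{1..2}. A i) = A 1 \<inter> A 2" for A :: "nat \<Rightarrow> ('a, 'b) max_prod set"
    using ball_1_2[of "\<lambda>i. _ \<in> A i"] by auto
  show ?thesis (is "?L \<longleftrightarrow> ?R")
  proof
    assume L: ?L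
    show ?R
    proof (intro allI impI)
      fix u v x y
      assume asm: "y \<in> F x" "norm (u - x) \<le> r" "norm (v - y) \<le> r" "norm (v - yb) \<le> r"
        "norm (xb - u) \<le> \<delta>" "norm (yb - v) \<le> \<delta>"
      have "0 \<le> r"
        using asm(2) norm_ge_zero order_trans by blast
      then have "MaxPair u v \<in> \<Omega> 1 + cball 0 r" "MaxPair u v \<in> \<Omega> 2 + cball 0 r"
        unfolding plus Bex_def in_\<Omega>2_iff \<Omega>1 in_gph_iff max_prod_norm_le_iff
        using asm by (auto intro: exI[of _ "MaxPair x y"] exI[of _ "MaxPair u yb"])
      moreover have "MaxPair u v \<in> cball (MaxPair xb yb) \<delta>"
        unfolding max_prod_cball_iff using asm by blast
      ultimately have "MaxPair u v \<in> \<Omega> 1 \<inter> \<Omega> 2 + cball 0 \<rho>"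
        using L unfolding fattening_in_def Int by blast
      then obtain q where "msnd q \<in> F (mfst q)" "msnd q = yb" "norm (MaxPair u v - q) \<le> \<rho>"
        unfolding plus Bex_def Int_iff in_\<Omega>2_iff \<Omega>1 in_gph_iff by blast
      then show "norm (v - yb) \<le> \<rho> \<and> (\<exists>x'. yb \<in> F x' \<and> norm (u - x') \<le> \<rho>)"
        unfolding max_prod_norm_le_iff by auto
    qed
  next
    assume R: ?R
    show ?L
      unfolding fattening_in_def Int
    proof
      fix p assume "p \<in> (\<Omega> 1 + cball 0 r) \<inter> (\<Omega> 2 + cball 0 r) \<inter> cball (MaxPair xb yb) \<delta>"
      then obtain q q' where "msnd q \<in> F (mfst q)" "norm (p - q) \<le> r" "msnd q' = yb" "norm (p - q') \<le> r"
          "norm (MaxPair xb yb - p) \<le> \<delta>"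
        unfolding Int_iff plus Bex_def in_\<Omega>2_iff \<Omega>1 in_gph_iff mem_cball dist_norm by blast
      then have "norm (msnd p - yb) \<le> \<rho> \<and> (\<exists>x'. yb \<in> F x' \<and> norm (mfst p - x') \<le> \<rho>)"
        unfolding max_prod_norm_le_iff max_prod_sel max_prod.sel
        by (intro R[rule_format, of "msnd q" "mfst q"]) auto
      then obtain x' where "norm (msnd p - yb) \<le> \<rho>" "yb \<in> F x'" "norm (mfst p - x') \<le> \<rho>"
        by blast
      then show "p \<in> \<Omega> 1 \<inter> \<Omega> 2 + cball 0 \<rho>"
        unfolding plus Bex_def Int_iff in_\<Omega>2_iff \<Omega>1 in_gph_iff max_prod_norm_le_iff
        by (intro exI[of _ "MaxPair x' yb"]) simp
    qed
  qed
qed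

text \<open>The predicates substituted for \<open>S\<close> in \<open>regularity_rates\<close>. As
  abbreviations they coincide with the conditions in the supremum formulas for the
  constants.\<close>

abbreviation "semi_rate \<alpha> \<equiv> \<forall>\<^sub>F \<rho> in at_right 0. shift_meets 2 \<Omega> (MaxPair xb yb) \<rho> (\<alpha> * \<rho>)"

abbreviation "sub_rate \<alpha> \<equiv> \<exists>\<delta>>0. \<forall>\<rho>\<in>{0<..<\<delta>}. fattening_in 2 \<Omega> (MaxPair xb yb) \<delta> \<rho> (\<alpha> * \<rho>)"

abbreviation "uniform_rate \<alpha> \<equiv> \<exists>\<delta>>0. \<forall>\<rho>\<in>{0<..<\<delta>}. \<forall>\<omega>.
  (\<forall>i\<in>{1..2}. \<omega> i \<in> \<Omega> i \<inter> cball (MaxPair xb yb) \<delta>) \<longrightarrow>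
  shift_meets 2 (\<lambda>i. translate (\<Omega> i) (\<omega> i)) 0 \<rho> (\<alpha> * \<rho>)"

section \<open>Semiregularity: conversion of rates\<close>

lemma semi_rate_of_metric:
  assumes "metric_semireg_with F xb yb \<gamma>" "0 < \<gamma>'" "\<gamma>' < \<gamma>"
  shows "semi_rate (\<gamma>' / (\<gamma>' + 2))"
proof -
  obtain \<delta> where \<delta>: "0 < \<delta>"
      "\<And>y. norm (y - yb) \<le> \<delta> \<Longrightarrow> ennreal \<gamma> * set_dist xb (inv_map F y) \<le> ennreal (norm (y - yb))"
    using assms(1) unfolding metric_semireg_with_def by (auto simp: dist_norm norm_minus_commute)
  \<comment> \<open>Half of \<open>\<delta>\<close> suffices because \<open>w\<close> has norm at
    most twice the shift bound, hence at most \<open>2 * \<rho>\<close>.\<close>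
  have "shift_meets 2 \<Omega> (MaxPair xb yb) \<rho> (\<gamma>' / (\<gamma>' + 2) * \<rho>)" if \<rho>: "0 < \<rho>" "\<rho> < \<delta> / 2" for \<rho>
  proof -
    have r: "\<gamma>' / (\<gamma>' + 2) * \<rho> \<le> \<rho>"
      using assms(2) \<rho> by (simp add: field_simps)
    have "hits F xb yb \<rho> (\<gamma>' / (\<gamma>' + 2) * \<rho>)"
    proof (rule hits_of_set_dist_le)
      fix w :: 'b assume "norm w \<le> 2 * (\<gamma>' / (\<gamma>' + 2) * \<rho>)"
      then have "norm w \<le> \<delta>"
        using r \<rho> by linarith
      then show "ennreal \<gamma> * set_dist xb (inv_map F (yb + w)) \<le> ennreal (norm w)"
        using \<delta>(2)[of "yb + w"] by simp
    qed (use assms \<rho> yb_in in auto)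
    then have "shift_meets 2 (\<lambda>i. translate (\<Omega> i) (MaxPair xb yb)) 0 \<rho> (\<gamma>' / (\<gamma>' + 2) * \<rho>)"
      using r by (intro shift_meets_of_hits) auto
    then show ?thesis
      by (simp add: shift_meets_translate)
  qed
  then show ?thesis
    unfolding eventually_at_right_field using \<delta>(1) by (intro exI[of _ "\<delta> / 2"]) auto
qed

lemma metric_of_semi_rate:
  assumes "0 < \<alpha>" "semi_rate \<alpha>"
  shows "metric_semireg_with F xb yb (2 * \<alpha>)"
proof -
  obtain \<delta> where \<delta>: "0 < \<delta>"
      "\<And>\<rho>. 0 < \<rho> \<Longrightarrow> \<rho> < \<delta> \<Longrightarrow> shift_meets 2 \<Omega> (MaxPair xb yb) \<rho> (\<alpha> * \<rho>)"
    using assms(2) unfolding eventually_at_right_field by auto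
  have hits: "hits F xb yb \<rho> (\<alpha> * \<rho>)" if "0 < \<rho>" "\<rho> < \<delta>" for \<rho>
    using hits_of_shift_meets[of "\<lambda>_. MaxPair xb yb"] \<delta>(2)[OF that]
    by (simp add: shift_meets_translate)
  \<comment> \<open>The radius \<open>\<alpha> * \<delta>\<close> keeps \<open>norm (y - yb)\<close>
    strictly below \<open>2 * \<alpha> * \<delta>\<close>, as \<open>hits_solution\<close>
    demands.\<close>
  have "ennreal (2 * \<alpha>) * set_dist xb (inv_map F y) \<le> ennreal (norm (y - yb))"
    if "norm (y - yb) \<le> \<alpha> * \<delta>" for y
  proof -
    have "0 < \<alpha> * \<delta>"
      using assms(1) \<delta>(1) by simp
    then have "norm (y - yb) < 2 * \<alpha> * \<delta>"
      using that by linarith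
    with hits yb_in assms(1) obtain x' where
      "x' \<in> inv_map F (yb + (y - yb))" "2 * \<alpha> * norm (xb - x') \<le> norm (y - yb)"
      by (rule hits_solution)
    then show ?thesis
      using assms(1) by (intro mult_set_dist_le) auto
  qed
  then show ?thesis
    unfolding metric_semireg_with_def using assms(1) \<delta>(1)
    by (intro exI[of _ "\<alpha> * \<delta>"]) (auto simp: dist_norm norm_minus_commute)
qed

section \<open>Subregularity: conversion of rates\<close>

lemma sub_rate_of_metric:
  assumes "metric_subreg_with F xb yb \<gamma>" "0 < \<gamma>'" "\<gamma>' < \<gamma>"
  shows "sub_rate (\<gamma>' / (\<gamma>' + 2))"
proof -
  obtain \<delta> where \<delta>: "0 < \<delta>"
      "\<And>x. norm (xb - x) \<le> \<delta> \<Longrightarrow> ennreal \<gamma> * set_dist x (inv_map F yb) \<le> set_dist yb (F x)"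
    using assms(1) unfolding metric_subreg_with_def by (auto simp: dist_norm)
  \<comment> \<open>The graph point has \<open>x\<close> within \<open>\<delta> / 2 + \<rho>\<close>
    of \<open>xb\<close>, which stays below \<open>\<delta>\<close>.\<close>
  have "fattening_in 2 \<Omega> (MaxPair xb yb) (\<delta> / 2) \<rho> (\<gamma>' / (\<gamma>' + 2) * \<rho>)"
    if \<rho>: "0 < \<rho>" "\<rho> < \<delta> / 2" for \<rho>
    unfolding fattening_in_iff
  proof (intro allI impI)
    let ?r = "\<gamma>' / (\<gamma>' + 2) * \<rho>"
    fix u v x y
    assume y: "y \<in> F x" and ux: "norm (u - x) \<le> ?r" and vy: "norm (v - y) \<le> ?r"
      and v: "norm (v - yb) \<le> ?r" and u: "norm (xb - u) \<le> \<delta> / 2"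
    have r: "?r \<le> \<rho>" "0 < ?r"
      using assms(2) \<rho> by (simp_all add: field_simps)
    have r_split: "2 * ?r / \<gamma>' + ?r = \<rho>"
      using assms(2) by (rule rate_split)
    have "norm (xb - x) \<le> norm (xb - u) + norm (u - x)"
      using norm_triangle_ineq[of "xb - u" "u - x"] by simp
    then have "norm (xb - x) \<le> \<delta>"
      using ux u r \<rho> by linarith
    then have "ennreal \<gamma> * set_dist x (inv_map F yb) \<le> set_dist yb (F x)"
      by (rule \<delta>(2))
    also have "\<dots> \<le> ennreal (norm (yb - y))"
      unfolding set_dist_def by (rule INF_lower[OF y])
    finally have dist: "ennreal \<gamma> * set_dist x (inv_map F yb) \<le> ennreal (norm (yb - y))" .
    \<comment> \<open>The route from \<open>y\<close> to \<open>yb\<close> through \<open>v\<close>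
      costs one fattening radius for each of the two sets, whence the factor 2.\<close>
    have "norm (yb - y) \<le> norm (v - y) + norm (v - yb)"
      using norm_triangle_ineq4[of "v - y" "v - yb"] by simp
    then have "norm (yb - y) \<le> 2 * ?r"
      using vy v by linarith
    also have "2 * ?r = \<gamma>' * (2 * ?r / \<gamma>')"
      using assms(2) by simp
    also have "\<dots> < \<gamma> * (2 * ?r / \<gamma>')"
      using \<rho> assms(2,3) by (intro mult_strict_right_mono) auto
    finally have "norm (yb - y) < \<gamma> * (2 * ?r / \<gamma>')" .
    moreover have "0 < 2 * ?r / \<gamma>'" "0 < \<gamma>"
      using \<rho> assms(2,3) by auto
    ultimately obtain x' where x': "x' \<in> inv_map F yb" "norm (x - x') \<le> 2 * ?r / \<gamma>'"
      using set_dist_obtain_near[OF dist] by blast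
    have "norm (u - x') \<le> norm (u - x) + norm (x - x')"
      using norm_triangle_ineq[of "u - x" "x - x'"] by simp
    then have "norm (u - x') \<le> \<rho>"
      using ux x'(2) r_split by linarith
    then show "norm (v - yb) \<le> \<rho> \<and> (\<exists>x'. yb \<in> F x' \<and> norm (u - x') \<le> \<rho>)"
      using x'(1) v r(1) by (auto simp: inv_map_def)
  qed
  then show ?thesis
    using \<delta>(1) by (intro exI[of _ "\<delta> / 2"]) auto
qed

text \<open>For \<open>y\<close> in \<open>F x\<close> close to \<open>yb\<close>, the point over
  \<open>x\<close> at the midpoint of \<open>y\<close> and \<open>yb\<close> lies in both fattened
  sets with radius \<open>norm (yb - y) / 2\<close>, and this halving gives the rate
  \<open>2 * \<alpha>\<close>.\<close>

lemma metric_of_sub_rate: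
  assumes "0 < \<alpha>" "sub_rate \<alpha>"
  shows "metric_subreg_with F xb yb (2 * \<alpha>)"
proof -
  obtain \<delta> where \<delta>: "0 < \<delta>"
      "\<And>\<rho>. 0 < \<rho> \<Longrightarrow> \<rho> < \<delta> \<Longrightarrow> fattening_in 2 \<Omega> (MaxPair xb yb) \<delta> \<rho> (\<alpha> * \<rho>)"
    using assms(2) by auto
  \<comment> \<open>The bound by \<open>\<delta>\<close> keeps \<open>x\<close> in the ball and
    makes the radius used below smaller than \<open>\<delta>\<close>; the bound by
    \<open>\<delta> / \<alpha>\<close> keeps the midpoint in the ball.\<close>
  define \<delta>' where "\<delta>' = min \<delta> (\<delta> / \<alpha>)"
  have \<delta>': "0 < \<delta>'" "\<delta>' \<le> \<delta>" "\<alpha> * \<delta>' \<le> \<delta>" "\<alpha> * \<delta>' \<le> \<alpha> * \<delta>"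
    using assms(1) \<delta>(1) by (auto simp: \<delta>'_def min_def field_simps)
  have "ennreal (2 * \<alpha>) * set_dist x (inv_map F yb) \<le> ennreal (norm (yb - y))"
    if x: "norm (xb - x) \<le> \<delta>'" and y: "y \<in> F x" for x y
  proof (cases "norm (yb - y) < 2 * (\<alpha> * \<delta>')")
    case True
    show ?thesis
    proof (cases "y = yb")
      case True
      then show ?thesis
        using y assms(1) by (intro mult_set_dist_le[of x]) (auto simp: inv_map_def)
    next
      case False
      define \<rho> where "\<rho> = norm (yb - y) / (2 * \<alpha>)"
      define v where "v = (1/2) *\<^sub>R (y + yb)"
      have "v - y = (1/2) *\<^sub>R (yb - y)" "v - yb = - ((1/2) *\<^sub>R (yb - y))"
        using scaleR_half_double[of y] scaleR_half_double[of yb]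
        unfolding v_def scaleR_add_right scaleR_diff_right by (simp_all add: algebra_simps)
      then have v: "norm (v - y) = norm (yb - y) / 2" "norm (v - yb) = norm (yb - y) / 2"
        by simp_all
      have "norm (yb - y) < 2 * (\<alpha> * \<delta>)"
        using True \<delta>'(4) by linarith
      then have \<rho>: "0 < \<rho>" "\<rho> < \<delta>" "norm (yb - y) = 2 * (\<alpha> * \<rho>)"
        using False assms(1) by (auto simp: \<rho>_def field_simps)
      have "norm (yb - v) \<le> \<delta>"
        using True v(2) \<delta>'(3) by (simp add: norm_minus_commute)
      then obtain x' where "yb \<in> F x'" "norm (x - x') \<le> \<rho>"
        using \<delta>(2)[OF \<rho>(1,2)] y x v \<rho> \<delta>'(2) assms(1) unfolding fattening_in_iff
        by (elim allE[of _ x] allE[of _ v] allE[of _ y]) auto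
      then show ?thesis
        using assms(1) \<rho>(3) by (intro mult_set_dist_le[of x']) (auto simp: inv_map_def)
    qed
  next
    case False
    \<comment> \<open>When \<open>y\<close> is this far from \<open>yb\<close>, the solution
      \<open>xb\<close> itself is close enough to \<open>x\<close>.\<close>
    have "\<alpha> * norm (xb - x) \<le> \<alpha> * \<delta>'"
      using x assms(1) by simp
    then have "2 * \<alpha> * norm (x - xb) \<le> norm (yb - y)"
      using False by (simp add: norm_minus_commute)
    then show ?thesis
      using yb_in assms(1) by (intro mult_set_dist_le[of xb]) (auto simp: inv_map_def)
  qed
  then have "ennreal (2 * \<alpha>) * set_dist x (inv_map F yb) \<le> set_dist yb (F x)"
    if "norm (xb - x) \<le> \<delta>'" for x
    unfolding set_dist_def[of yb] using that by (intro INF_greatest)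
  then show ?thesis
    unfolding metric_subreg_with_def using \<delta>'(1)
    by (intro exI[of _ \<delta>']) (auto simp: dist_norm)
qed

text \<open>Moving the reference point vertically by \<open>e\<close> of norm
  \<open>\<alpha> * \<rho>\<close> stays in both fattened sets, yet all common points have height
  \<open>yb\<close>; so \<open>\<alpha> * \<rho> \<le> \<rho>\<close>. The vector \<open>e\<close>
  exists because \<open>'b\<close> is nontrivial.\<close>

lemma sub_rate_le_1:
  assumes "sub_rate \<alpha>" "(UNIV :: 'b set) \<noteq> {0}"
  shows "\<alpha> \<le> 1"
proof (rule ccontr)
  assume \<alpha>: "\<not> \<alpha> \<le> 1"
  obtain \<delta> where \<delta>: "0 < \<delta>"
      "\<And>\<rho>. 0 < \<rho> \<Longrightarrow> \<rho> < \<delta> \<Longrightarrow> fattening_in 2 \<Omega> (MaxPair xb yb) \<delta> \<rho> (\<alpha> * \<rho>)"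
    using assms(1) by auto
  obtain v :: 'b where "v \<noteq> 0"
    using assms(2) by blast
  \<comment> \<open>This gives \<open>\<alpha> * \<rho> = \<delta> / 2\<close>, so the moved point
    stays in the ball, and \<open>\<rho> < \<delta>\<close> because \<open>\<alpha>\<close> exceeds
    1.\<close>
  define \<rho> where "\<rho> = \<delta> / (2 * \<alpha>)"
  define e where "e = (\<alpha> * \<rho>) *\<^sub>R sgn v"
  have \<rho>: "0 < \<rho>" "\<rho> < \<delta>" "\<rho> < \<alpha> * \<rho>" "\<alpha> * \<rho> \<le> \<delta>"
    using \<alpha> \<delta>(1) by (auto simp: \<rho>_def field_simps)
  have "norm e = \<alpha> * \<rho>"
    using \<open>v \<noteq> 0\<close> \<rho> \<alpha> by (simp add: e_def norm_sgn)
  then have "norm e \<le> \<rho>"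
    using \<delta>(2)[OF \<rho>(1,2)] yb_in \<rho> \<delta>(1) unfolding fattening_in_iff
    by (elim allE[of _ xb] allE[of _ "yb + e"] allE[of _ yb]) auto
  with \<open>norm e = \<alpha> * \<rho>\<close> \<rho>(3) show False
    by simp
qed

section \<open>Uniform regularity: conversion of rates\<close>

lemma uniform_rate_of_metric:
  assumes "metric_reg_with F xb yb \<gamma>" "0 < \<gamma>'" "\<gamma>' < \<gamma>"
  shows "uniform_rate (\<gamma>' / (\<gamma>' + 2))"
proof -
  obtain \<delta> where \<delta>: "0 < \<delta>"
      "\<And>x y. norm (xb - x) \<le> \<delta> \<Longrightarrow> norm (yb - y) \<le> \<delta> \<Longrightarrow>
        ennreal \<gamma> * set_dist x (inv_map F y) \<le> set_dist y (F x)"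
    using assms(1) unfolding metric_reg_with_def max_prod_cball_iff by blast
  \<comment> \<open>A third of \<open>\<delta>\<close> goes to the distance of \<open>y\<close> from
    \<open>yb\<close>, the other two to \<open>norm w\<close>, which is at most
    \<open>2 * \<rho>\<close>.\<close>
  have "shift_meets 2 (\<lambda>i. translate (\<Omega> i) (\<omega> i)) 0 \<rho> (\<gamma>' / (\<gamma>' + 2) * \<rho>)"
    if \<rho>: "0 < \<rho>" "\<rho> < \<delta> / 3" and \<omega>: "\<forall>i\<in>{1..2}. \<omega> i \<in> \<Omega> i \<inter> cball (MaxPair xb yb) (\<delta> / 3)" for \<rho> \<omega>
  proof (rule shift_meets_of_hits)
    show r: "\<gamma>' / (\<gamma>' + 2) * \<rho> \<le> \<rho>"
      using assms(2) \<rho> by (simp add: field_simps)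
    show "msnd (\<omega> 2) = yb"
      using \<omega> unfolding ball_1_2 Int_iff in_\<Omega>2_iff by simp
    define x y where "x = mfst (\<omega> 1)" and "y = msnd (\<omega> 1)"
    have xy: "y \<in> F x" "norm (xb - x) \<le> \<delta> / 3" "norm (yb - y) \<le> \<delta> / 3"
      using \<omega> unfolding ball_1_2 Int_iff \<Omega>1 in_gph_iff mem_cball dist_norm max_prod_norm_le_iff
      by (simp_all add: x_def y_def)
    have "hits F x y \<rho> (\<gamma>' / (\<gamma>' + 2) * \<rho>)"
    proof (rule hits_of_set_dist_le)
      fix w :: 'b assume w: "norm w \<le> 2 * (\<gamma>' / (\<gamma>' + 2) * \<rho>)"
      have "norm (yb - (y + w)) \<le> norm (yb - y) + norm w"
        using norm_triangle_ineq4[of "yb - y" w] by (simp add: algebra_simps)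
      then have "norm (yb - (y + w)) \<le> \<delta>" "norm (xb - x) \<le> \<delta>"
        using w r \<rho> xy \<delta>(1) by linarith+
      then have "ennreal \<gamma> * set_dist x (inv_map F (y + w)) \<le> set_dist (y + w) (F x)"
        by (intro \<delta>(2))
      also have "\<dots> \<le> ennreal (norm (y + w - y))"
        unfolding set_dist_def by (rule INF_lower[OF xy(1)])
      finally show "ennreal \<gamma> * set_dist x (inv_map F (y + w)) \<le> ennreal (norm w)"
        by simp
    qed (use assms \<rho> xy in auto)
    then show "hits F (mfst (\<omega> 1)) (msnd (\<omega> 1)) \<rho> (\<gamma>' / (\<gamma>' + 2) * \<rho>)"
      by (simp add: x_def y_def)
  qed
  then show ?thesis
    using \<delta>(1) by (intro exI[of _ "\<delta> / 3"]) auto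
qed

text \<open>The set condition speaks only of graph points near the reference point, whereas
  \<open>F x\<close> may contain values far from \<open>yb\<close>. Values of \<open>F x\<close>
  within \<open>\<sigma>\<close> of \<open>y\<close> are handled from their own graph point, the
  others from the reference point.\<close>

lemma metric_of_uniform_rate:
  assumes "0 < \<alpha>" "uniform_rate \<alpha>"
  shows "metric_reg_with F xb yb (2 * \<alpha>)"
proof -
  obtain \<delta> where \<delta>: "0 < \<delta>"
    and meets: "\<And>\<rho> \<omega>. 0 < \<rho> \<Longrightarrow> \<rho> < \<delta> \<Longrightarrow> \<forall>i\<in>{1..2}. \<omega> i \<in> \<Omega> i \<inter> cball (MaxPair xb yb) \<delta> \<Longrightarrow>
        shift_meets 2 (\<lambda>i. translate (\<Omega> i) (\<omega> i)) 0 \<rho> (\<alpha> * \<rho>)"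
    using assms(2) by auto
  have hits: "hits F x y \<rho> (\<alpha> * \<rho>)"
    if "0 < \<rho>" "\<rho> < \<delta>" "y \<in> F x" "norm (xb - x) \<le> \<delta>" "norm (yb - y) \<le> \<delta>" for x y \<rho>
  proof -
    define \<omega> where "\<omega> i = (if i = 1 then MaxPair x y else MaxPair xb yb)" for i :: nat
    have "\<forall>i\<in>{1..2}. \<omega> i \<in> \<Omega> i \<inter> cball (MaxPair xb yb) \<delta>"
      unfolding ball_1_2 Int_iff in_\<Omega>2_iff \<Omega>1 using that \<delta>
      by (simp add: \<omega>_def in_gph_iff max_prod_cball_iff del: mem_cball)
    from hits_of_shift_meets[OF meets[OF that(1,2) this]] show ?thesis
      by (simp add: \<omega>_def)
  qed
  \<comment> \<open>The bound \<open>\<delta> / 2\<close> keeps nearby values of \<open>F x\<close>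
    within \<open>\<delta>\<close> of \<open>yb\<close>; the bound
    \<open>\<alpha> * \<delta>\<close> makes \<open>hits_solution\<close> applicable in both
    cases.\<close>
  define \<sigma> where "\<sigma> = min (\<delta> / 2) (\<alpha> * \<delta>)"
  \<comment> \<open>Chosen so that \<open>2 * \<alpha> * \<delta>' + \<delta>' = \<sigma>\<close>:
    the error of replacing \<open>x\<close> by \<open>xb\<close> plus that of \<open>y\<close>
    against \<open>yb\<close> is absorbed by \<open>norm (y - y1)\<close> in the far case.\<close>
  define \<delta>' where "\<delta>' = \<sigma> / (2 * \<alpha> + 1)"
  have \<sigma>: "0 < \<sigma>" "\<sigma> \<le> \<delta> / 2" "\<sigma> \<le> \<alpha> * \<delta>"
    using \<delta> assms(1) by (auto simp: \<sigma>_def)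
  have "0 < \<delta>'"
    using \<sigma>(1) assms(1) by (simp add: \<delta>'_def)
  moreover have "(2 * \<alpha> + 1) * \<delta>' = \<sigma>"
    using assms(1) by (simp add: \<delta>'_def)
  ultimately have \<delta>': "0 < \<delta>'" "2 * \<alpha> * \<delta>' + \<delta>' = \<sigma>"
    by (simp_all add: distrib_right)
  have \<delta>'_le: "\<delta>' \<le> \<sigma>"
    using \<delta>' assms(1) mult_pos_pos[of \<alpha> \<delta>'] by linarith
  have pos: "0 < \<alpha> * \<delta>"
    using \<delta> assms(1) by simp
  have "ennreal (2 * \<alpha>) * set_dist x (inv_map F y) \<le> ennreal (norm (y - y1))"
    if x: "norm (xb - x) \<le> \<delta>'" and y: "norm (yb - y) \<le> \<delta>'" and y1: "y1 \<in> F x" for x y y1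
  proof (cases "norm (y - y1) < \<sigma>")
    case True
    have "norm (yb - y1) \<le> norm (yb - y) + norm (y - y1)"
      using norm_triangle_ineq[of "yb - y" "y - y1"] by simp
    then have near: "norm (yb - y1) \<le> \<delta>" "norm (xb - x) \<le> \<delta>"
      using True x y \<sigma> \<delta>'_le \<delta> by linarith+
    have "norm (y - y1) < 2 * \<alpha> * \<delta>"
      using True \<sigma>(3) pos by linarith
    with hits[OF _ _ y1 near(2,1)] y1 assms(1) obtain x' where
      "x' \<in> inv_map F (y1 + (y - y1))" "2 * \<alpha> * norm (x - x') \<le> norm (y - y1)"
      by (rule hits_solution)
    then show ?thesis
      using assms(1) by (intro mult_set_dist_le[of x']) auto
  next
    \<comment> \<open>If \<open>y1\<close> is far from \<open>y\<close>, a solution near \<open>xb\<close> is good enough.\<close>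
    case False
    have base_near: "norm (xb - xb) \<le> \<delta>" "norm (yb - yb) \<le> \<delta>"
      using \<delta> by auto
    have "norm (y - yb) < 2 * \<alpha> * \<delta>"
      using y \<sigma>(3) \<delta>'_le pos by (simp add: norm_minus_commute)
    with hits[OF _ _ yb_in base_near] yb_in assms(1) obtain x' where
      x': "x' \<in> inv_map F (yb + (y - yb))" "2 * \<alpha> * norm (xb - x') \<le> norm (y - yb)"
      by (rule hits_solution)
    have "norm (x - x') \<le> norm (xb - x) + norm (xb - x')"
      using norm_triangle_ineq4[of "xb - x'" "xb - x"] by simp
    then have "2 * \<alpha> * norm (x - x') \<le> 2 * \<alpha> * norm (xb - x) + 2 * \<alpha> * norm (xb - x')"
      using assms(1) by (simp flip: distrib_left)
    also have "\<dots> \<le> 2 * \<alpha> * \<delta>' + \<delta>'"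
      using x y x'(2) assms(1) by (intro add_mono mult_left_mono) (auto simp: norm_minus_commute)
    finally show ?thesis
      using False \<delta>'(2) x'(1) assms(1) by (intro mult_set_dist_le[of x']) auto
  qed
  then have "ennreal (2 * \<alpha>) * set_dist x (inv_map F y) \<le> set_dist y (F x)"
    if "norm (xb - x) \<le> \<delta>'" "norm (yb - y) \<le> \<delta>'" for x y
    unfolding set_dist_def[of y] using that by (intro INF_greatest)
  then show ?thesis
    unfolding metric_reg_with_def max_prod_cball_iff using \<delta>'(1) by blast
qed

text \<open>Constant base points at the reference point and the single radius
  \<open>\<delta> / 2\<close> reduce this to \<open>shift_meets_rate_le\<close>.\<close>

lemma uniform_rate_le_1:
  assumes "uniform_rate \<alpha>" "0 < \<alpha>" "(UNIV :: 'b set) \<noteq> {0}"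
  shows "\<alpha> \<le> 1"
proof -
  obtain \<delta> where \<delta>: "0 < \<delta>"
    and meets: "\<And>\<rho> \<omega>. 0 < \<rho> \<Longrightarrow> \<rho> < \<delta> \<Longrightarrow> \<forall>i\<in>{1..2}. \<omega> i \<in> \<Omega> i \<inter> cball (MaxPair xb yb) \<delta> \<Longrightarrow>
        shift_meets 2 (\<lambda>i. translate (\<Omega> i) (\<omega> i)) 0 \<rho> (\<alpha> * \<rho>)"
    using assms(1) by auto
  have "\<forall>i\<in>{1..2}. MaxPair xb yb \<in> \<Omega> i \<inter> cball (MaxPair xb yb) \<delta>"
    unfolding ball_1_2 in_\<Omega>2_iff \<Omega>1 using base \<delta> by (auto simp: in_\<Omega>2_iff)
  then have "shift_meets 2 (\<lambda>i. translate (\<Omega> i) (MaxPair xb yb)) 0 (\<delta> / 2) (\<alpha> * (\<delta> / 2))"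
    using \<delta> by (intro meets) auto
  then have "\<alpha> * (\<delta> / 2) \<le> \<delta> / 2"
    by (rule shift_meets_rate_le) (use \<delta> assms in auto)
  then show ?thesis
    using \<delta> by simp
qed

lemmas semi_rates = regularity_rates[of "metric_semireg_with F xb yb" semi_rate,
    OF semi_rate_of_metric metric_of_semi_rate]

lemmas sub_rates = regularity_rates[of "metric_subreg_with F xb yb" sub_rate,
    OF sub_rate_of_metric metric_of_sub_rate]

lemmas uniform_rates = regularity_rates[of "metric_reg_with F xb yb" uniform_rate,
    OF uniform_rate_of_metric metric_of_uniform_rate]

end

theorem theorem5p1:
  fixes F :: "'a::real_normed_vector \<Rightarrow> 'b::real_normed_vector set"
    and xb :: 'a and yb :: 'b
    and \<Omega> :: "nat \<Rightarrow> ('a, 'b) max_prod set"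
  assumes "MaxPair xb yb \<in> gph F"
    and "\<Omega> 1 = gph F"
    and "\<Omega> 2 = {MaxPair x yb | x. x \<in> UNIV}"
  shows
    "((metrically_semiregular F xb yb \<longleftrightarrow> semiregular 2 \<Omega> (MaxPair xb yb)) \<and>
      frac2 (map_theta F xb yb) \<le> coll_theta 2 \<Omega> (MaxPair xb yb) \<and>
      coll_theta 2 \<Omega> (MaxPair xb yb) \<le> map_theta F xb yb / 2) \<and>
     ((metrically_subregular F xb yb \<longleftrightarrow> subregular 2 \<Omega> (MaxPair xb yb)) \<and>
      frac2 (map_zeta F xb yb) \<le> coll_zeta 2 \<Omega> (MaxPair xb yb) \<and>
      ((UNIV :: 'b set) \<noteq> {0} \<longrightarrow>
        coll_zeta 2 \<Omega> (MaxPair xb yb) \<le> min (map_zeta F xb yb / 2) 1)) \<and>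
     ((metrically_regular F xb yb \<longleftrightarrow> uniformly_regular 2 \<Omega> (MaxPair xb yb)) \<and>
      frac2 (map_theta_hat F xb yb) \<le> coll_theta_hat 2 \<Omega> (MaxPair xb yb) \<and>
      ((UNIV :: 'b set) \<noteq> {0} \<longrightarrow>
        coll_theta_hat 2 \<Omega> (MaxPair xb yb) \<le> min (map_theta_hat F xb yb / 2) 1))"
proof -
  interpret graph_and_level F xb yb \<Omega>
    by unfold_locales fact+
  have zeta_1: "coll_zeta 2 \<Omega> (MaxPair xb yb) \<le> 1" if "(UNIV :: 'b set) \<noteq> {0}"
    unfolding coll_zeta_eq_SUP
  proof (rule SUP_least)
    fix \<alpha> assume "\<alpha> \<in> {\<alpha>. 0 < \<alpha> \<and> sub_rate \<alpha>}"
    then show "ennreal \<alpha> \<le> 1"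
      using sub_rate_le_1[OF _ that] by (simp add: ennreal_le_1)
  qed
  have theta_hat_1: "coll_theta_hat 2 \<Omega> (MaxPair xb yb) \<le> 1" if "(UNIV :: 'b set) \<noteq> {0}"
    unfolding coll_theta_hat_eq_SUP
  proof (rule SUP_least)
    fix \<alpha> assume "\<alpha> \<in> {\<alpha>. 0 < \<alpha> \<and> uniform_rate \<alpha>}"
    then show "ennreal \<alpha> \<le> 1"
      using uniform_rate_le_1[OF _ _ that] by (simp add: ennreal_le_1)
  qed
  \<comment> \<open>With all constants rewritten as suprema of rates, the three instances of
    \<open>regularity_rates\<close> give the equivalences and the bounds by \<open>frac2\<close> and
    by half; \<open>min.boundedI\<close> adds the bounds by 1.\<close>
  show ?thesis
    using semi_rates sub_rates uniform_rates zeta_1 theta_hat_1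
    unfolding metrically_semiregular_def metrically_subregular_def metrically_regular_def
      map_theta_def map_zeta_def map_theta_hat_def
      semiregular_iff_eventually subregular_iff_fattening_in uniformly_regular_iff_eventually
      coll_theta_eq_SUP coll_zeta_eq_SUP coll_theta_hat_eq_SUP
    by (intro conjI impI min.boundedI)
qed

end
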